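(* Consider the hierarchical Gaussian $K$-armed bandit and the algorithm HierTS described in the context, run for $n$ rounds. Let $c > 0$ be a constant such that $c\, \hat{\sigma}_{t,i}^{-2} \geq \hat{\sigma}_{t+1,i}^{-2}$ holds for every node $i \in \mathcal{V}$ and every round $t$. For any $\delta \in (0,1]$, the Bayes regret of HierTS satisfies \[ \mathcal{BR}(n) \leq \sqrt{2 n \mathcal{G}(n) \log(1/\delta)} + \sqrt{2/\pi}\, \sigma_{\max} K n \delta\,, \] where $\mathcal{G}(n) = \sum_{i \in \mathcal{V}} c^{h_i} w_i$, with \[ w_i = \frac{\sigma_{0,i}^2}{\log\big(1 + \sigma_{0,i}^2/\sigma^2\big)} \log\Big(1 + \frac{\sigma_{0,i}^2 n}{\sigma^2}\Big) \] for an action node $i$ (for which $h_i = 0$), and \[ w_i = \frac{\sigma_{0,i}^2}{\log\big(1 + \sigma_{0,i}^2/\sigma^2\big)} \log\Big(1 + \sigma_{0,i}^2 \sum_{j \in \mathsf{ch}(i)} \sigma_{0,j}^{-2}\Big) \] for a non-action node $i$ (for which $h_i > 0$).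
   Context: Tree and model. Let $\mathcal{T}$ be a rooted tree with node set $\mathcal{V}$, root labeled $1$, in which every internal node has at least $2$ children. For a node $i \neq 1$, $\mathsf{pa}(i)$ is its parent; $\mathsf{ch}(i)$ is the set of children of $i$. The leaves form the action set $\mathcal{A}$, $|\mathcal{A}| = K$. The height $h_i$ of node $i$ is the maximum length of a path from $i$ down to a leaf descendant (leaves have height $0$). Node parameters $\theta_{*, i} \in \mathbb{R}$ are generated as $\theta_{*, 1} \sim \mathcal{N}(\mu_1, \sigma_{0,1}^2)$ and, for $i \neq 1$, $\theta_{*, i} \mid \theta_{*, \mathsf{pa}(i)} \sim \mathcal{N}(\theta_{*, \mathsf{pa}(i)}, \sigma_{0,i}^2)$, with known $\mu_1$ and $\sigma_{0,i} > 0$. In each round $t = 1,\dots,n$ the agent takes $A_t \in \mathcal{A}$ and observes $Y_t \sim \mathcal{N}(\theta_{*, A_t}, \sigma^2)$ (independent noise, known $\sigma > 0$). The history is $H_t = (A_\ell, Y_\ell)_{\ell < t}$. Algorithm HierTS. In each round $t$, HierTS draws $\Theta_t = (\theta_{t,i})_{i \in \mathcal{V}}$ exactly from the posterior of $(\theta_{*,i})_{i \in \mathcal{V}}$ given $H_t$ (root from its posterior, then each node from its posterior conditioned on $H_t$ and the sampled parent value), takes $A_t = \arg\max_{a \in \mathcal{A}} \theta_{t,a}$, and observes $Y_t$. Bayes regret. With $A_* = \arg\max_{a} \theta_{*, a}$, $\mathcal{BR}(n) = \mathbb{E}\big[\sum_{t=1}^n (\theta_{*, A_*} - \theta_{*,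 A_t})\big]$, expectation over $\Theta_*$, rewards and algorithm randomness. $\sigma_{\max} = \max_{a \in \mathcal{A}} \sqrt{\mathrm{Var}(\theta_{*,a})} = \max_{a} \big(\sum_{j \in \psi_a} \sigma_{0,j}^2\big)^{1/2}$, where $\psi_a$ is the set of nodes on the path from the root to $a$ (inclusive). Conditional posterior variances. For a node $i \neq 1$, $\hat{\sigma}_{t,i}^2$ is the variance of $\theta_{*, i}$ conditioned on $H_t$ and on $\theta_{*, \mathsf{pa}(i)}$ (independent of the parent's value); for the root, $\hat{\sigma}_{t,1}^2 = \mathrm{Var}(\theta_{*,1} \mid H_t)$. Explicitly, with $\mathcal{S}_{t,a} = \{\ell < t : A_\ell = a\}$: for an action node $a$, $\hat{\sigma}_{t,a}^{-2} = \sigma_{0,a}^{-2} + |\mathcal{S}_{t,a}| \sigma^{-2}$; for a non-action node $i$, $\hat{\sigma}_{t,i}^{-2} = \sigma_{0,i}^{-2} + \sum_{j \in \mathsf{ch}(i)} \tilde{\sigma}_{t,j}^{-2}$, where recursively $\tilde{\sigma}_{t,j}^{2} = \sigma_{0,j}^2 + \sigma^2/|\mathcal{S}_{t,j}|$ for an action node $j$ (with $\tilde{\sigma}_{t,j}^{-2} = 0$ if $|\mathcal{S}_{t,j}| = 0$) and $\tilde{\sigma}_{t,j}^{2} = \sigma_{0,j}^2 + \big(\sum_{k \in \mathsf{ch}(j)} \tilde{\sigma}_{t,k}^{-2}\big)^{-1}$ for a non-action node $j$. *)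

theory Defs
  imports "HOL-Probability.Probability"
begin

definition ch :: "'v set \<Rightarrow> 'v \<Rightarrow> ('v \<Rightarrow> 'v) \<Rightarrow> 'v \<Rightarrow> 'v set" where
  "ch V r pa i = {j \<in> V - {r}. pa j = i}"

definition leaves :: "'v set \<Rightarrow> 'v \<Rightarrow> ('v \<Rightarrow> 'v) \<Rightarrow> 'v set" where
  "leaves V r pa = {i \<in> V. ch V r pa i = {}}"

definition is_tree :: "'v set \<Rightarrow> 'v \<Rightarrow> ('v \<Rightarrow> 'v) \<Rightarrow> bool" where
  "is_tree V r pa \<longleftrightarrow> finite V \<and> r \<in> V \<and> (\<forall>i\<in>V - {r}. pa i \<in> V)
     \<and> (\<forall>i\<in>V. \<exists>k. (pa ^^ k) i = r)
     \<and> (\<forall>i\<in>V. ch V r pa i \<noteq> {} \<longrightarrow> card (ch V r pa i) \<ge> 2)"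

definition height :: "'v set \<Rightarrow> 'v \<Rightarrow> ('v \<Rightarrow> 'v) \<Rightarrow> 'v \<Rightarrow> nat" where
  "height V r pa i = Max {k. \<exists>j\<in>leaves V r pa. (pa ^^ k) j = i \<and> (\<forall>m<k. (pa ^^ m) j \<noteq> r)}"

definition anc :: "'v \<Rightarrow> ('v \<Rightarrow> 'v) \<Rightarrow> 'v \<Rightarrow> 'v set" where
  "anc r pa a = {(pa ^^ k) a | k. \<forall>m<k. (pa ^^ m) a \<noteq> r}"

text \<open>Number of pulls of a among the first k rounds (k = t - 1 past rounds at round t).\<close>
definition cnt :: "(nat \<Rightarrow> 'v) \<Rightarrow> nat \<Rightarrow> 'v \<Rightarrow> nat" where
  "cnt acts k a = card {l. l < k \<and> acts l = a}"

text \<open>tilde sigma^{-2}, computed with a fuel parameter (fuel \<ge> height suffices; we use card V).\<close>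
fun tprec :: "'v set \<Rightarrow> 'v \<Rightarrow> ('v \<Rightarrow> 'v) \<Rightarrow> ('v \<Rightarrow> real) \<Rightarrow> real \<Rightarrow> (nat \<Rightarrow> 'v) \<Rightarrow> nat
              \<Rightarrow> nat \<Rightarrow> 'v \<Rightarrow> real" where
  "tprec V r pa s0 s acts k 0 j =
     (if j \<in> leaves V r pa then
        (if cnt acts k j = 0 then 0 else 1 / ((s0 j)\<^sup>2 + s\<^sup>2 / real (cnt acts k j)))
      else 0)"
| "tprec V r pa s0 s acts k (Suc f) j =
     (if j \<in> leaves V r pa then
        (if cnt acts k j = 0 then 0 else 1 / ((s0 j)\<^sup>2 + s\<^sup>2 / real (cnt acts k j)))
      else (let S = (\<Sum>l\<in>ch V r pa j. tprec V r pa s0 s acts k f l) in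
            if S = 0 then 0 else 1 / ((s0 j)\<^sup>2 + 1 / S)))"

definition hat_prec :: "'v set \<Rightarrow> 'v \<Rightarrow> ('v \<Rightarrow> 'v) \<Rightarrow> ('v \<Rightarrow> real) \<Rightarrow> real \<Rightarrow> (nat \<Rightarrow> 'v)
                        \<Rightarrow> nat \<Rightarrow> 'v \<Rightarrow> real" where
  "hat_prec V r pa s0 s acts k i =
     1 / (s0 i)\<^sup>2 + (if i \<in> leaves V r pa then real (cnt acts k i) / s\<^sup>2
                    else (\<Sum>j\<in>ch V r pa i. tprec V r pa s0 s acts k (card V) j))"

text \<open>Prior: theta_i = mu1 + sum over the root-to-i path of independent N(0, s0_j^2) increments,
  i.e. theta_1 ~ N(mu1, s0_1^2), theta_i | theta_pa(i) ~ N(theta_pa(i), s0_i^2).\<close>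
definition prior :: "'v set \<Rightarrow> 'v \<Rightarrow> ('v \<Rightarrow> 'v) \<Rightarrow> real \<Rightarrow> ('v \<Rightarrow> real) \<Rightarrow> ('v \<Rightarrow> real) measure" where
  "prior V r pa mu s0 =
     distr (\<Pi>\<^sub>M j\<in>V. density lborel (normal_density 0 (s0 j))) (\<Pi>\<^sub>M i\<in>V. (borel :: real measure))
           (\<lambda>Z. \<lambda>i\<in>V. mu + (\<Sum>j\<in>anc r pa i. Z j))"

text \<open>State: (true parameters, history); history entry l = (A_{l+1}, Y_{l+1}).\<close>
definition stateM :: "'v set \<Rightarrow> (('v \<Rightarrow> real) \<times> (nat \<Rightarrow> 'v \<times> real)) measure" where
  "stateM V = (\<Pi>\<^sub>M i\<in>V. (borel :: real measure)) \<Otimes>\<^sub>M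
              (\<Pi>\<^sub>M l\<in>(UNIV :: nat set). (count_space UNIV \<Otimes>\<^sub>M (borel :: real measure)))"

definition lik :: "real \<Rightarrow> nat \<Rightarrow> (nat \<Rightarrow> 'v \<times> real) \<Rightarrow> ('v \<Rightarrow> real) \<Rightarrow> real" where
  "lik s k h th = (\<Prod>l<k. normal_density (th (fst (h l))) s (snd (h l)))"

definition posterior :: "('v \<Rightarrow> real) measure \<Rightarrow> real \<Rightarrow> nat \<Rightarrow> (nat \<Rightarrow> 'v \<times> real)
                          \<Rightarrow> ('v \<Rightarrow> real) measure" where
  "posterior P s k h =
     density P (\<lambda>th. ennreal (lik s k h th) / (\<integral>\<^sup>+ th'. ennreal (lik s k h th') \<partial>P))"

fun hts_law :: "'v set \<Rightarrow> 'v \<Rightarrow> ('v \<Rightarrow> 'v) \<Rightarrow> real \<Rightarrow> ('v \<Rightarrow> real) \<Rightarrow> real \<Rightarrow> nat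
                \<Rightarrow> (('v \<Rightarrow> real) \<times> (nat \<Rightarrow> 'v \<times> real)) measure" where
  "hts_law V r pa mu s0 s 0 = distr (prior V r pa mu s0) (stateM V) (\<lambda>th. (th, \<lambda>_. undefined))"
| "hts_law V r pa mu s0 s (Suc t) =
     bind (hts_law V r pa mu s0 s t) (\<lambda>(th, h).
       bind (posterior (prior V r pa mu s0) s t h) (\<lambda>Th.
         let a = arg_max_on Th (leaves V r pa) in
         distr (density lborel (normal_density (th a) s)) (stateM V)
               (\<lambda>y. (th, h(t := (a, y))))))"

definition bayes_regret :: "'v set \<Rightarrow> 'v \<Rightarrow> ('v \<Rightarrow> 'v) \<Rightarrow> real \<Rightarrow> ('v \<Rightarrow> real) \<Rightarrow> real \<Rightarrow> nat \<Rightarrow> real" where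
  "bayes_regret V r pa mu s0 s n =
     (\<integral> x. (\<Sum>t<n. Max (fst x ` leaves V r pa) - fst x (fst (snd x t))) \<partial>hts_law V r pa mu s0 s n)"

definition sigma_max :: "'v set \<Rightarrow> 'v \<Rightarrow> ('v \<Rightarrow> 'v) \<Rightarrow> ('v \<Rightarrow> real) \<Rightarrow> real" where
  "sigma_max V r pa s0 = Max ((\<lambda>a. sqrt (\<Sum>j\<in>anc r pa a. (s0 j)\<^sup>2)) ` leaves V r pa)"

definition wgt :: "'v set \<Rightarrow> 'v \<Rightarrow> ('v \<Rightarrow> 'v) \<Rightarrow> ('v \<Rightarrow> real) \<Rightarrow> real \<Rightarrow> nat \<Rightarrow> 'v \<Rightarrow> real" where
  "wgt V r pa s0 s n i =
     (s0 i)\<^sup>2 / ln (1 + (s0 i)\<^sup>2 / s\<^sup>2) *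
     (if i \<in> leaves V r pa then ln (1 + (s0 i)\<^sup>2 * real n / s\<^sup>2)
      else ln (1 + (s0 i)\<^sup>2 * (\<Sum>j\<in>ch V r pa i. 1 / (s0 j)\<^sup>2)))"

definition G :: "'v set \<Rightarrow> 'v \<Rightarrow> ('v \<Rightarrow> 'v) \<Rightarrow> ('v \<Rightarrow> real) \<Rightarrow> real \<Rightarrow> real \<Rightarrow> nat \<Rightarrow> real" where
  "G V r pa s0 s c n = (\<Sum>i\<in>V. c ^ height V r pa i * wgt V r pa s0 s n i)"

end

theory Submission
  imports Defs
begin

text \<open>
  Given the history, the optimal action and the sampled action have the same law, so with the
  upper confidence bound \<open>m\<^sub>a + \<kappa> sd\<^sub>a\<close> (posterior mean and standard deviation,
  \<open>\<kappa>\<^sup>2 = 2 log (1/\<delta>)\<close>) the regret of a round is at most \<open>\<kappa>\<close> times the standard deviation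
  of the chosen action plus the Gaussian excesses, each at most
  \<open>sd\<^sub>a \<delta> / sqrt (2 \<pi>)\<close>. By Cauchy--Schwarz it remains to sum posterior variances along a fixed
  action sequence. The variance of a leaf splits, by the law of total variance, into one summand per
  ancestor \<open>i\<close>; since the precision of \<open>i\<close> grows by a factor that this summand controls up to
  \<open>c ^ h\<^sub>i\<close>, the summands of \<open>i\<close> telescope to \<open>c ^ h\<^sub>i * w\<^sub>i\<close>.
\<close>

section \<open>Tree structure and posterior precisions\<close>

text \<open>The posterior is given by Bayes' formula as a density over all node values, whereas the
  bound speaks of recursive precisions; the two are tied by integrating out nodes from the bottom of
  the tree. Only the one-dimensional marginals of the leaves are needed afterwards, so no joint
  posterior covariance appears. The precisions depend on which leaves were pulled and not on the
  rewards, so the sum of variances is bounded for each leaf sequence separately, and the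
  Cauchy--Schwarz step can be made pathwise. The factor \<open>c\<close> arises because a precision
  increment at a child reaches the parent damped by both the old and the new precision, while the
  variance summand contains the old one twice; trading one for the other costs \<open>c\<close> per
  edge, hence \<open>c ^ h\<close> at height \<open>h\<close>. The number of leaves enters because
  the optimal action is random: its Gaussian excess is bounded by the sum of the excesses of all
  leaves. Expectations over histories are handled as nonnegative integrals, which need no
  integrability.\<close>

lemma ln_one_plus_scaled_ge:
  fixes l u :: real
  assumes "0 \<le> l" "l \<le> 1" "0 \<le> u"
  shows "l * ln (1 + u) \<le> ln (1 + l * u)"
proof -
  have "concave_on {0<..} (ln :: real \<Rightarrow> real)"
    by (rule ln_concave)
  from concave_onD[OF this, of l 1 "1 + u"] assms
  show ?thesis by (simp add: algebra_simps)
qed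

text \<open>Concavity again, now with the factor outside: this is how powers of \<open>c\<close>
  leave the logarithm of a precision ratio.\<close>

lemma ln_one_plus_mult_le:
  fixes c y :: real
  assumes "1 \<le> c" "0 \<le> y"
  shows "ln (1 + c * y) \<le> c * ln (1 + y)"
  using ln_one_plus_scaled_ge[of "1 / c" "c * y"] assms by (simp add: field_simps)

text \<open>The quotient of \<open>x\<close> and \<open>ln (1 + x / s)\<close> is nondecreasing, so
  its value at the upper bound \<open>u\<close> dominates. With \<open>u\<close> the variance
  parameter of a node and the noise variance in place of \<open>s\<close>, this is the origin of the
  prefactor of the weights.\<close>

lemma le_ratio_mult_ln:
  fixes x u s :: real
  assumes "0 \<le> x" "x \<le> u" "0 < u" "0 < s"
  shows "x \<le> u / ln (1 + u / s) * ln (1 + x / s)"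
proof -
  have pos: "0 < ln (1 + u / s)" using assms by (intro ln_gt_zero) auto
  have "(x / u) * ln (1 + u / s) \<le> ln (1 + (x / u) * (u / s))"
    using assms by (intro ln_one_plus_scaled_ge) auto
  also have "(x / u) * (u / s) = x / s" using assms by simp
  finally show ?thesis using pos assms by (simp add: field_simps)
qed

locale gauss_tree =
  fixes V :: "'v set" and r :: 'v and pa :: "'v \<Rightarrow> 'v"
    and mu s :: real and s0 :: "'v \<Rightarrow> real"
  assumes tree: "is_tree V r pa"
    and s_pos: "s > 0"
    and s0_pos: "\<And>i. i \<in> V \<Longrightarrow> s0 i > 0"
begin

section \<open>Depth, ancestor paths and induction on the tree\<close>

abbreviation "L \<equiv> leaves V r pa"
abbreviation "C \<equiv> ch V r pa"

text \<open>\<open>pa r\<close> is unconstrained, so iterates beyond the first visit to the root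
  carry no meaning; the least number of steps avoids them.\<close>

definition depth :: "'v \<Rightarrow> nat" where
  "depth i = (LEAST k. (pa ^^ k) i = r)"

lemma finite_V [simp]: "finite V" and r_V [simp]: "r \<in> V"
  using tree by (auto simp: is_tree_def)

lemma pa_V [simp]: "i \<in> V \<Longrightarrow> i \<noteq> r \<Longrightarrow> pa i \<in> V"
  using tree by (auto simp: is_tree_def)

lemma L_sub: "L \<subseteq> V" by (auto simp: leaves_def)

lemma finite_L [simp]: "finite L"
  using L_sub finite_V finite_subset by blast

lemma C_sub: "C i \<subseteq> V" by (auto simp: ch_def)

lemma finite_C [simp]: "finite (C i)"
  using C_sub finite_V finite_subset by blast

lemma C_leaf [simp]: "i \<in> L \<Longrightarrow> C i = {}" by (auto simp: leaves_def)

lemma depth_r [simp]: "depth r = 0"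
  unfolding depth_def by (rule Least_equality) auto

lemma pa_depth: assumes "i \<in> V" shows "(pa ^^ depth i) i = r"
proof -
  obtain k where "(pa ^^ k) i = r" using tree assms by (auto simp: is_tree_def)
  thus ?thesis unfolding depth_def by (rule LeastI)
qed

lemma depth_pa: assumes "i \<in> V" "i \<noteq> r" shows "depth i = Suc (depth (pa i))"
proof -
  note k = pa_depth[OF assms(1)]
  have "depth i = Suc (LEAST m. (pa ^^ Suc m) i = r)"
    unfolding depth_def by (rule Least_Suc[where n = "depth i"]) (use assms k in auto)
  thus ?thesis by (simp only: depth_def funpow_Suc_right comp_apply)
qed

lemma depth_child: "j \<in> C i \<Longrightarrow> depth j = Suc (depth i)"
  using depth_pa by (auto simp: ch_def)

lemma tree_induct [consumes 1, case_names root step]: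
  assumes "i \<in> V" "P r" "\<And>i. i \<in> V \<Longrightarrow> i \<noteq> r \<Longrightarrow> P (pa i) \<Longrightarrow> P i"
  shows "P i"
  using assms(1)
proof (induction "depth i" arbitrary: i rule: less_induct)
  case less
  show ?case
    by (cases "i = r") (use assms less depth_pa[of i] in auto)
qed

lemma anc_r [simp]: "anc r pa r = {r}"
proof -
  have "(\<forall>m<k. (pa ^^ m) r \<noteq> r) \<longleftrightarrow> k = 0" for k
    by (cases k) (auto intro!: exI[of _ 0])
  thus ?thesis by (auto simp: anc_def)
qed

lemma anc_step: assumes "i \<noteq> r" shows "anc r pa i = insert i (anc r pa (pa i))"
proof (intro set_eqI iffI)
  fix x assume "x \<in> anc r pa i"
  then obtain k where k: "x = (pa ^^ k) i" "\<forall>m<k. (pa ^^ m) i \<noteq> r" by (auto simp: anc_def)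
  show "x \<in> insert i (anc r pa (pa i))"
  proof (cases k)
    case 0 thus ?thesis using k by auto
  next
    case (Suc k')
    have "(pa ^^ m) (pa i) \<noteq> r" if "m < k'" for m
      using k(2)[rule_format, of "Suc m"] that Suc by (simp add: funpow_swap1)
    thus ?thesis using k(1) Suc by (auto simp: anc_def funpow_swap1)
  qed
next
  fix x assume "x \<in> insert i (anc r pa (pa i))"
  thus "x \<in> anc r pa i"
  proof
    assume "x = i" thus ?thesis by (auto simp: anc_def intro!: exI[of _ 0])
  next
    assume "x \<in> anc r pa (pa i)"
    then obtain k where k: "x = (pa ^^ k) (pa i)" "\<forall>m<k. (pa ^^ m) (pa i) \<noteq> r"
      by (auto simp: anc_def)
    have "(pa ^^ m) i \<noteq> r" if "m < Suc k" for m
      using k(2) assms that by (cases m) (auto simp: funpow_swap1)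
    thus ?thesis using k(1) unfolding anc_def
      by (intro CollectI exI[of _ "Suc k"]) (auto simp: funpow_swap1)
  qed
qed

lemma anc_V: assumes "i \<in> V" shows "anc r pa i \<subseteq> V"
  using assms by (induction rule: tree_induct) (auto simp: anc_step)

lemma finite_anc [simp]: "i \<in> V \<Longrightarrow> finite (anc r pa i)"
  using anc_V finite_V finite_subset by blast

lemma depth_anc: assumes "i \<in> V" shows "j \<in> anc r pa i \<Longrightarrow> depth j \<le> depth i"
  using assms
  by (induction arbitrary: j rule: tree_induct) (auto simp: anc_step depth_pa intro: le_SucI)

lemma notin_anc_pa: assumes "i \<in> V" "i \<noteq> r" shows "i \<notin> anc r pa (pa i)"
  using depth_anc[of "pa i" i] depth_pa assms by auto

lemma sum_anc: assumes "i \<in> V" "i \<noteq> r"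
  shows "(\<Sum>j\<in>anc r pa i. f j) = (f i :: real) + (\<Sum>j\<in>anc r pa (pa i). f j)"
  using assms notin_anc_pa by (simp add: anc_step)

lemma card_anc: assumes "i \<in> V" shows "card (anc r pa i) = Suc (depth i)"
  using assms
  by (induction rule: tree_induct) (auto simp: anc_step notin_anc_pa depth_pa)

text \<open>The ancestors of \<open>i\<close> are \<open>depth i + 1\<close> distinct nodes of
  \<open>V\<close>. This is why the fuel \<open>card V\<close> suffices in the recursion for the
  precisions.\<close>

lemma depth_less: assumes "i \<in> V" shows "depth i < card V"
  using card_mono[OF finite_V anc_V[OF assms]] card_anc[OF assms] by auto

text \<open>Depth is bounded by \<open>card V\<close>, and the distance to that bound decreases from
  a node to its children; this yields induction from the leaves towards the root.\<close>

lemma tree_induct_up [consumes 1, case_names node]: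
  assumes "i \<in> V" "\<And>i. i \<in> V \<Longrightarrow> (\<And>j. j \<in> C i \<Longrightarrow> P j) \<Longrightarrow> P i"
  shows "P i"
  using assms(1)
proof (induction "card V - depth i" arbitrary: i rule: less_induct)
  case less
  show ?case
  proof (rule assms(2)[OF less.prems])
    fix j assume j: "j \<in> C i"
    have "j \<in> V" using j C_sub by auto
    thus "P j" using less.hyps[of j] depth_child[OF j] depth_less[of j] by simp
  qed
qed

lemma leaves_nonempty: "L \<noteq> {}"
proof
  assume "L = {}"
  have False if "i \<in> V" for i
    using that
  proof (induction rule: tree_induct_up)
    case (node i)
    have "i \<notin> L" using \<open>L = {}\<close> by blast
    with node(1) have "C i \<noteq> {}" unfolding leaves_def by blast
    thus False using node(2) by blast
  qed
  thus False using r_V by blast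
qed

section \<open>Conditional precisions as Gaussian messages from children to parents\<close>

abbreviation tp :: "(nat \<Rightarrow> 'v) \<Rightarrow> nat \<Rightarrow> 'v \<Rightarrow> real" where
  "tp acts k \<equiv> tprec V r pa s0 s acts k (card V)"
abbreviation hat :: "(nat \<Rightarrow> 'v) \<Rightarrow> nat \<Rightarrow> 'v \<Rightarrow> real" where
  "hat acts k \<equiv> hat_prec V r pa s0 s acts k"

text \<open>Each recursive call spends one unit of fuel and goes one level deeper, so
  \<open>f + depth j\<close> is constant along the recursion, and any fuel that lasts beyond the
  deepest level gives the same value. The recursion then holds with the fuel \<open>card V\<close>
  on both sides.\<close>

lemma tprec_fuel:
  assumes "j \<in> V" "card V \<le> f + depth j"
  shows "tprec V r pa s0 s acts k f j = tp acts k j"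
  using assms
proof (induction arbitrary: f rule: tree_induct_up)
  case (node i)
  obtain f' where f: "f = Suc f'" using node depth_less[of i] by (cases f) auto
  obtain g where g: "card V = Suc g" using depth_less[OF node(1)] by (cases "card V") auto
  have "tprec V r pa s0 s acts k f' j = tprec V r pa s0 s acts k g j" if "j \<in> C i" for j
    using node(2)[OF that, of f'] node(2)[OF that, of g] node(3) depth_child[OF that] f g by simp
  thus ?case by (simp add: f g cong: sum.cong)
qed

lemma tp_nonneg: "0 \<le> tp acts k j"
proof -
  have "0 \<le> tprec V r pa s0 s acts k f j" for f
    by (induction f arbitrary: j) (auto simp: Let_def intro!: sum_nonneg add_nonneg_nonneg)
  thus ?thesis .
qed

text \<open>Leaves have no children and inner nodes no observations, so with this term a single
  formula for \<open>hat\<close> covers both kinds of node.\<close>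

definition obsprec :: "(nat \<Rightarrow> 'v) \<Rightarrow> nat \<Rightarrow> 'v \<Rightarrow> real" where
  "obsprec acts k i = (if i \<in> L then real (cnt acts k i) / s\<^sup>2 else 0)"

lemma hat_eq: "hat acts k i = 1 / (s0 i)\<^sup>2 + obsprec acts k i + (\<Sum>j\<in>C i. tp acts k j)"
  by (auto simp: hat_prec_def obsprec_def)

lemma obsprec_nonneg [simp]: "0 \<le> obsprec acts k i"
  by (simp add: obsprec_def)

lemma hat_ge: "1 / (s0 i)\<^sup>2 \<le> hat acts k i"
  by (simp add: hat_eq tp_nonneg sum_nonneg add_nonneg_nonneg)

lemma hat_pos: "i \<in> V \<Longrightarrow> 0 < hat acts k i"
  using hat_ge[of i acts k] s0_pos[of i] by (metis less_le_trans zero_less_divide_1_iff zero_less_power)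

lemma inv_hat_le: "i \<in> V \<Longrightarrow> 1 / hat acts k i \<le> (s0 i)\<^sup>2"
  using hat_ge[of i acts k] hat_pos[of i acts k] s0_pos[of i] by (simp add: field_simps)

text \<open>With \<open>g = 1 / (s0 j)\<^sup>2\<close> and \<open>S\<close> the precision arriving
  from below, \<open>1 / (1 / g + 1 / S) = g - g\<^sup>2 / (g + S)\<close>: the Schur complement
  left when \<open>j\<close> is eliminated from the joint precision of \<open>j\<close> and its
  parent. This form is regular at \<open>S = 0\<close>, which the recursion treats separately, and
  it is the form that integrating out \<open>j\<close> produces.\<close>

lemma tp_eq:
  assumes "j \<in> V"
  shows "tp acts k j = 1 / (s0 j)\<^sup>2 - 1 / ((s0 j)^4 * hat acts k j)"
proof -
  have s0: "0 < s0 j" using s0_pos assms by auto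
  obtain g where g: "card V = Suc g" using depth_less[OF assms] by (cases "card V") auto
  have alg: "(if S = 0 then 0 else 1 / ((s0 j)\<^sup>2 + 1 / S))
      = 1 / (s0 j)\<^sup>2 - 1 / ((s0 j)^4 * (1 / (s0 j)\<^sup>2 + S))" if "S \<ge> 0" for S
  proof -
    have pos: "0 < 1 + (s0 j)\<^sup>2 * S" using that s0 by (auto intro!: add_pos_nonneg)
    have 1: "(s0 j)^4 * (1 / (s0 j)\<^sup>2 + S) = (s0 j)\<^sup>2 * (1 + (s0 j)\<^sup>2 * S)"
      using s0 by (simp add: field_simps power4_eq_xxxx power2_eq_square)
    have "(if S = 0 then 0 else 1 / ((s0 j)\<^sup>2 + 1 / S)) = S / (1 + (s0 j)\<^sup>2 * S)"
      using that by (simp add: divide_simps)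
    also have "\<dots> = 1 / (s0 j)\<^sup>2 - 1 / ((s0 j)\<^sup>2 * (1 + (s0 j)\<^sup>2 * S))"
    proof -
      have "1 / a - 1 / (a * (1 + a * S)) = S / (1 + a * S)" if "a > 0" "1 + a * S > 0" for a
        using that by (simp add: divide_simps)
      thus ?thesis using pos s0 by simp
    qed
    finally show ?thesis unfolding 1 .
  qed
  show ?thesis
  proof (cases "j \<in> L")
    case True
    let ?S = "real (cnt acts k j) / s\<^sup>2"
    have "tp acts k j = (if ?S = 0 then 0 else 1 / ((s0 j)\<^sup>2 + 1 / ?S))"
      using True s_pos by (simp add: g)
    moreover have "hat acts k j = 1 / (s0 j)\<^sup>2 + ?S"
      using True by (simp add: hat_eq obsprec_def)
    moreover have "0 \<le> ?S" by simp
    ultimately show ?thesis by (simp only: alg)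
  next
    case False
    let ?S = "\<Sum>l\<in>C j. tp acts k l"
    have "tprec V r pa s0 s acts k g l = tp acts k l" if "l \<in> C j" for l
      by (rule tprec_fuel) (use that C_sub g depth_child[OF that] in auto)
    hence "tp acts k j = (if ?S = 0 then 0 else 1 / ((s0 j)\<^sup>2 + 1 / ?S))"
      using False by (simp only: g tprec.simps Let_def if_False) (simp cong: sum.cong)
    moreover have "0 \<le> ?S" by (simp add: tp_nonneg sum_nonneg)
    moreover have "hat acts k j = 1 / (s0 j)\<^sup>2 + ?S" using False by (simp add: hat_eq obsprec_def)
    ultimately show ?thesis by (simp only: alg)
  qed
qed

lemma tp_le: "j \<in> V \<Longrightarrow> tp acts k j \<le> 1 / (s0 j)\<^sup>2"
  using tp_eq[of j acts k] hat_pos[of j acts k] s0_pos[of j] by (simp add: less_imp_le)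

lemma cnt_Suc: "cnt acts (Suc k) a = cnt acts k a + (if acts k = a then 1 else 0)"
proof -
  have "{l. l < Suc k \<and> acts l = a} = {l. l < k \<and> acts l = a} \<union> (if acts k = a then {k} else {})"
    by (auto simp: less_Suc_eq)
  thus ?thesis unfolding cnt_def by auto
qed

lemma cnt_0 [simp]: "cnt acts 0 a = 0"
  by (simp add: cnt_def)

lemma cnt_le: "cnt acts k a \<le> k"
  by (induction k) (auto simp: cnt_Suc)

lemma tp_mono: 
  assumes "j \<in> V" "hat acts k j \<le> hat acts k' j"
  shows "tp acts k j \<le> tp acts k' j"
proof -
  have "0 < s0 j" "0 < hat acts k j" using assms s0_pos hat_pos by auto
  hence "1 / ((s0 j)^4 * hat acts k' j) \<le> 1 / ((s0 j)^4 * hat acts k j)"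
    using assms by (intro divide_left_mono mult_pos_pos mult_left_mono) auto
  thus ?thesis using assms by (simp add: tp_eq)
qed

lemma hat_mono: assumes "i \<in> V" shows "hat acts k i \<le> hat acts (Suc k) i"
  using assms
proof (induction rule: tree_induct_up)
  case (node i)
  have "obsprec acts k i \<le> obsprec acts (Suc k) i"
    using s_pos by (auto simp: obsprec_def cnt_Suc divide_right_mono)
  moreover have "(\<Sum>j\<in>C i. tp acts k j) \<le> (\<Sum>j\<in>C i. tp acts (Suc k) j)"
    by (rule sum_mono) (use node C_sub in \<open>auto intro: tp_mono\<close>)
  ultimately show ?case by (simp add: hat_eq)
qed

lemma hat_0: assumes "i \<in> V" shows "hat acts 0 i = 1 / (s0 i)\<^sup>2"
  using assms
proof (induction rule: tree_induct_up)
  case (node i)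
  have "tp acts 0 j = 0" if "j \<in> C i" for j
    using that node(2) C_sub tp_eq[of j acts 0] s0_pos[of j]
    by (force simp: field_simps power4_eq_xxxx power2_eq_square)
  thus ?case by (simp add: hat_eq obsprec_def cnt_def)
qed

text \<open>Posterior variance of a node by the law of total variance along the path from the root.\<close>

fun pvar_aux :: "('v \<Rightarrow> real) \<Rightarrow> nat \<Rightarrow> 'v \<Rightarrow> real" where
  "pvar_aux H 0 i = 1 / H i"
| "pvar_aux H (Suc d) i = 1 / H i + (1 / (H i * (s0 i)\<^sup>2))\<^sup>2 * pvar_aux H d (pa i)"

definition pvar :: "('v \<Rightarrow> real) \<Rightarrow> 'v \<Rightarrow> real" where
  "pvar H i = pvar_aux H (depth i) i"

lemma pvar_r: "pvar H r = 1 / H r"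
  by (simp add: pvar_def)

lemma pvar_step: "i \<in> V \<Longrightarrow> i \<noteq> r \<Longrightarrow>
    pvar H i = 1 / H i + (1 / (H i * (s0 i)\<^sup>2))\<^sup>2 * pvar H (pa i)"
  by (simp add: pvar_def depth_pa)

lemma pvar_pos: assumes "i \<in> V" "\<And>i. i \<in> V \<Longrightarrow> 0 < H i" shows "0 < pvar H i"
  using assms(1)
  by (induction rule: tree_induct) (auto simp: pvar_r pvar_step assms(2) intro!: add_pos_nonneg)

text \<open>The quotient is the coefficient of the parent's value in the conditional mean of
  \<open>i\<close>. As it lies between 0 and 1, posterior variances stay below prior ones and
  products of squared coefficients along a path stay below 1.\<close>

lemma shrink_le_1: "i \<in> V \<Longrightarrow> 0 \<le> 1 / (hat acts k i * (s0 i)\<^sup>2) \<and> 1 / (hat acts k i * (s0 i)\<^sup>2) \<le> 1"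
  using hat_ge[of i acts k] hat_pos[of i acts k] s0_pos[of i] by (simp add: field_simps)

lemma pvar_le: assumes "i \<in> V" shows "pvar (hat acts k) i \<le> (\<Sum>j\<in>anc r pa i. (s0 j)\<^sup>2)"
  using assms
proof (induction rule: tree_induct)
  case root thus ?case by (simp add: pvar_r inv_hat_le)
next
  case (step i)
  have "(1 / (hat acts k i * (s0 i)\<^sup>2))\<^sup>2 * pvar (hat acts k) (pa i) \<le> 1 * pvar (hat acts k) (pa i)"
    using shrink_le_1[of i acts k] step pvar_pos[of "pa i" "hat acts k"] hat_pos
    by (intro mult_right_mono) (auto simp: power_le_one less_imp_le)
  thus ?case using step inv_hat_le[of i acts k] by (simp add: pvar_step sum_anc)
qed

text \<open>The path length \<open>k\<close> belongs to the set whose maximum defines the height;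
  the point is that this set is finite, by the bound on depths, since \<open>Max\<close> of an
  infinite set says nothing.\<close>

lemma height_ge:
  assumes "a \<in> L" "(pa ^^ k) a = i" "\<forall>m<k. (pa ^^ m) a \<noteq> r"
  shows "k \<le> height V r pa i"
proof -
  have bd: "k \<le> depth j" if "j \<in> V" "\<forall>m<k. (pa ^^ m) j \<noteq> r" for j k
  proof -
    have "\<not> depth j < k" using that(2) pa_depth[OF that(1)] by blast
    thus ?thesis by simp
  qed
  have "finite {k. \<exists>j\<in>L. (pa ^^ k) j = i \<and> (\<forall>m<k. (pa ^^ m) j \<noteq> r)}"
  proof (rule finite_subset)
    show "{k. \<exists>j\<in>L. (pa ^^ k) j = i \<and> (\<forall>m<k. (pa ^^ m) j \<noteq> r)} \<subseteq> {..card V}"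
    proof safe
      fix k j assume j: "j \<in> L" and k: "\<forall>m<k. (pa ^^ m) j \<noteq> r"
      have "j \<in> V" using j L_sub by blast
      from bd[OF this k] depth_less[OF this] show "k \<le> card V" by simp
    qed
  qed simp
  thus ?thesis unfolding height_def using assms by (intro Max_ge) auto
qed

section \<open>Growth of the precisions in one round and the sum of posterior variances\<close>

definition ratio :: "'v \<Rightarrow> real" where
  "ratio i = (s0 i)\<^sup>2 / ln (1 + (s0 i)\<^sup>2 / s\<^sup>2)"

lemma ratio_nonneg [simp]: "i \<in> V \<Longrightarrow> 0 \<le> ratio i"
  using s0_pos[of i] s_pos by (simp add: ratio_def add_increasing)

text \<open>Twice the drop in conditional entropy of node \<open>i\<close> given its parent that is
  caused by the round with index \<open>k\<close>.\<close>

definition gain :: "(nat \<Rightarrow> 'v) \<Rightarrow> nat \<Rightarrow> 'v \<Rightarrow> real" where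
  "gain acts k i = ln (hat acts (Suc k) i / hat acts k i)"

lemma gain_nonneg: "i \<in> V \<Longrightarrow> 0 \<le> gain acts k i"
  using hat_mono[of i acts k] hat_pos[of i acts k] by (simp add: gain_def)

text \<open>With \<open>h\<close> and \<open>h'\<close> the precisions before and after the round,
  the message of \<open>j\<close> grows by exactly \<open>(h' - h) / (s0^4 * h * h')\<close>. The
  left side has \<open>h * h\<close> in place of \<open>h * h'\<close>; the growth condition in the
  form \<open>1 / h \<le> c / h'\<close> closes the gap. This is the price of one factor
  \<open>c\<close> per edge.\<close>

lemma tp_increment:
  assumes "j \<in> V" and c: "hat acts (Suc k) j \<le> c * hat acts k j" "c > 0"
  shows "(1 / (hat acts k j * (s0 j)\<^sup>2))\<^sup>2 * (hat acts (Suc k) j - hat acts k j)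
          \<le> c * (tp acts (Suc k) j - tp acts k j)"
proof -
  let ?h = "hat acts k j" and ?h' = "hat acts (Suc k) j"
  have pos: "0 < ?h" "0 < ?h'" "0 < s0 j" and le: "?h \<le> ?h'"
    using assms hat_pos s0_pos hat_mono by auto
  have eq: "tp acts (Suc k) j - tp acts k j = (?h' - ?h) / ((s0 j)^4 * (?h * ?h'))"
    using pos by (simp add: tp_eq[OF assms(1)] field_simps)
  have "(1 / (?h * (s0 j)\<^sup>2))\<^sup>2 * (?h' - ?h) = (?h' - ?h) / (s0 j)^4 / ?h * (1 / ?h)"
    using pos by (simp add: field_simps power2_eq_square power4_eq_xxxx)
  also have "\<dots> \<le> (?h' - ?h) / (s0 j)^4 / ?h * (c / ?h')"
    using pos le c by (intro mult_left_mono) (auto simp: field_simps)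
  also have "\<dots> = c * (tp acts (Suc k) j - tp acts k j)"
    using pos by (simp add: eq field_simps)
  finally show ?thesis .
qed

text \<open>
  In the applications \<open>P\<close> is the product of the squared shrinkage factors on the path of length \<open>l\<close>
  from the pulled leaf \<open>a\<close> up to \<open>i\<close>; every step upwards costs a factor \<open>c\<close> in the lower bound
  \<open>P / (c ^ l * s\<^sup>2)\<close> on the increment of the precision of \<open>i\<close>.
\<close>

lemma scaled_pvar_le:
  assumes c1: "c \<ge> 1"
    and c: "\<And>i. i \<in> V \<Longrightarrow> hat acts (Suc k) i \<le> c * hat acts k i"
    and a: "a \<in> L" and i: "i \<in> V"
  shows "(pa ^^ l) a = i \<Longrightarrow> \<forall>m<l. (pa ^^ m) a \<noteq> r \<Longrightarrow> 0 \<le> P \<Longrightarrow> P \<le> 1 \<Longrightarrow>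
     P / s\<^sup>2 \<le> c ^ l * (hat acts (Suc k) i - hat acts k i) \<Longrightarrow>
     P * pvar (hat acts k) i \<le> (\<Sum>j\<in>anc r pa i. c ^ height V r pa j * ratio j * gain acts k j)"
proof -
  \<comment> \<open>The bound for a single ancestor: \<open>P / hat acts k i\<close> is its summand
    in the posterior variance of the pulled leaf. It is at most \<open>(s0 i)\<^sup>2\<close>, hence
    dominated by \<open>ratio i\<close> times a logarithm, and the lower bound on the precision
    increment turns that logarithm into \<open>c ^ l\<close> times the gain.\<close>
  have one: "P / hat acts k i \<le> c ^ height V r pa i * ratio i * gain acts k i"
    if i: "i \<in> V" and p: "(pa ^^ l) a = i" "\<forall>m<l. (pa ^^ m) a \<noteq> r" and P: "0 \<le> P" "P \<le> 1"
      and D: "P / s\<^sup>2 \<le> c ^ l * (hat acts (Suc k) i - hat acts k i)" for i l P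
  proof -
    let ?h = "hat acts k i" and ?h' = "hat acts (Suc k) i"
    have pos: "0 < ?h" "0 < s0 i" using i hat_pos s0_pos by auto
    have le: "?h \<le> ?h'" using hat_mono i by auto
    have y: "0 \<le> (?h' - ?h) / ?h" using pos le by simp
    have "P / ?h \<le> 1 * (1 / ?h)" using pos P by (simp add: divide_right_mono)
    also have "\<dots> \<le> (s0 i)\<^sup>2" using inv_hat_le[OF i] by simp
    finally have "P / ?h \<le> ratio i * ln (1 + P / ?h / s\<^sup>2)"
      unfolding ratio_def using pos P s_pos by (intro le_ratio_mult_ln) auto
    also have "\<dots> \<le> ratio i * (c ^ height V r pa i * gain acts k i)"
    proof (rule mult_left_mono[OF _ ratio_nonneg[OF i]])
      have "P / ?h / s\<^sup>2 \<le> c ^ l * ((?h' - ?h) / ?h)"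
        using D pos by (simp add: field_simps)
      hence "ln (1 + P / ?h / s\<^sup>2) \<le> ln (1 + c ^ l * ((?h' - ?h) / ?h))"
        using P pos by (intro ln_mono) (auto intro!: add_pos_nonneg)
      also have "\<dots> \<le> c ^ l * ln (1 + (?h' - ?h) / ?h)"
        using y c1 by (intro ln_one_plus_mult_le) auto
      also have "1 + (?h' - ?h) / ?h = ?h' / ?h" using pos by (simp add: field_simps)
      \<comment> \<open>Leaves below \<open>i\<close> may lie at different distances
        \<open>l\<close>; as \<open>c \<ge> 1\<close>, the height is an exponent that serves all of
        them.\<close>
      also have "c ^ l * ln (?h' / ?h) \<le> c ^ height V r pa i * gain acts k i"
        unfolding gain_def[symmetric] using c1 height_ge[OF a p] gain_nonneg[OF i]
        by (intro mult_right_mono power_increasing) auto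
      finally show "ln (1 + P / ?h / s\<^sup>2) \<le> c ^ height V r pa i * gain acts k i" .
    qed
    finally show ?thesis by (simp add: mult_ac)
  qed
  show "(pa ^^ l) a = i \<Longrightarrow> \<forall>m<l. (pa ^^ m) a \<noteq> r \<Longrightarrow> 0 \<le> P \<Longrightarrow> P \<le> 1 \<Longrightarrow>
     P / s\<^sup>2 \<le> c ^ l * (hat acts (Suc k) i - hat acts k i) \<Longrightarrow>
     P * pvar (hat acts k) i \<le> (\<Sum>j\<in>anc r pa i. c ^ height V r pa j * ratio j * gain acts k j)"
    using i
  proof (induction arbitrary: l P rule: tree_induct)
    case root
    thus ?case using one[OF r_V root(1-5)] by (simp add: pvar_r)
  next
    case (step i)
    let ?al = "1 / (hat acts k i * (s0 i)\<^sup>2)"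
    have al: "0 \<le> ?al\<^sup>2" "?al\<^sup>2 \<le> 1" using shrink_le_1[OF step(1)] by (auto simp: power_le_one)
    have iC: "i \<in> C (pa i)" using step by (auto simp: ch_def)
    \<comment> \<open>The precision of the parent collects the messages of all its children. None of
      them decreases, so it grows at least as much as the message of the child on the path.\<close>
    have inc: "tp acts (Suc k) i - tp acts k i \<le> hat acts (Suc k) (pa i) - hat acts k (pa i)"
    proof -
      have "pa i \<notin> L" using iC by auto
      hence "hat acts (Suc k) (pa i) - hat acts k (pa i)
              = (\<Sum>j\<in>C (pa i). tp acts (Suc k) j - tp acts k j)"
        by (simp add: hat_eq obsprec_def sum_subtractf)
      also have "\<dots> \<ge> tp acts (Suc k) i - tp acts k i"
        using iC C_sub hat_mono tp_mono by (intro member_le_sum) (auto, blast)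
      finally show ?thesis .
    qed
    \<comment> \<open>One edge up, the squared coefficient of \<open>i\<close> joins the product
      \<open>P\<close> and the exponent of \<open>c\<close> grows by one.\<close>
    have "(P * ?al\<^sup>2) * pvar (hat acts k) (pa i)
            \<le> (\<Sum>j\<in>anc r pa (pa i). c ^ height V r pa j * ratio j * gain acts k j)"
    proof (rule step.IH[of "Suc l"])
      show "(pa ^^ Suc l) a = pa i" using step by simp
      show "\<forall>m<Suc l. (pa ^^ m) a \<noteq> r" using step by (auto simp: less_Suc_eq)
      show "0 \<le> P * ?al\<^sup>2" "P * ?al\<^sup>2 \<le> 1" using step.prems(3,4) al by (auto simp: mult_le_one)
      have "P * ?al\<^sup>2 / s\<^sup>2 = P / s\<^sup>2 * ?al\<^sup>2" by simp
      also have "\<dots> \<le> c ^ l * (hat acts (Suc k) i - hat acts k i) * ?al\<^sup>2"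
        by (rule mult_right_mono[OF step.prems(5) al(1)])
      also have "\<dots> = c ^ l * (?al\<^sup>2 * (hat acts (Suc k) i - hat acts k i))" by simp
      also have "\<dots> \<le> c ^ l * (c * (tp acts (Suc k) i - tp acts k i))"
        using c1 c step(1) by (intro mult_left_mono tp_increment) auto
      also have "\<dots> \<le> c ^ l * (c * (hat acts (Suc k) (pa i) - hat acts k (pa i)))"
        using c1 inc by (intro mult_left_mono) auto
      finally show "P * ?al\<^sup>2 / s\<^sup>2 \<le> c ^ Suc l * (hat acts (Suc k) (pa i) - hat acts k (pa i))"
        by (simp add: mult_ac)
    qed
    moreover have "P / hat acts k i \<le> c ^ height V r pa i * ratio i * gain acts k i"
      by (rule one) (use step in auto)
    moreover have "P * pvar (hat acts k) i = P / hat acts k i + (P * ?al\<^sup>2) * pvar (hat acts k) (pa i)"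
      by (subst pvar_step[OF step(1,2)]) (simp add: distrib_left mult.assoc)
    ultimately show ?case using step by (simp add: sum_anc)
  qed
qed

lemma G_nonneg:
  assumes "c > 0" shows "0 \<le> G V r pa s0 s c n"
proof -
  have "0 \<le> wgt V r pa s0 s n i" if "i \<in> V" for i
    using ratio_nonneg[OF that] s0_pos[OF that] s_pos unfolding wgt_def ratio_def[symmetric]
    by (auto intro!: mult_nonneg_nonneg ln_ge_zero sum_nonneg)
  thus ?thesis unfolding G_def using assms by (intro sum_nonneg mult_nonneg_nonneg) auto
qed

lemma sum_pvar_le_G:
  assumes c0: "c > 0"
    and c: "\<And>k i. k < n \<Longrightarrow> i \<in> V \<Longrightarrow> hat acts (Suc k) i \<le> c * hat acts k i"
    and acts: "\<And>k. k < n \<Longrightarrow> acts k \<in> L"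
  shows "(\<Sum>k<n. pvar (hat acts k) (acts k)) \<le> G V r pa s0 s c n"
proof (cases "n = 0")
  case True thus ?thesis using G_nonneg c0 by simp
next
  case False
  \<comment> \<open>Precisions are positive and never decrease, so the growth condition itself
    forces \<open>c \<ge> 1\<close> once there is a round; this is why \<open>n = 0\<close> is split
    off.\<close>
  have c1: "1 \<le> c"
  proof -
    have "1 * hat acts 0 r \<le> c * hat acts 0 r"
      using c[of 0 r] hat_mono[of r acts 0] False by simp
    thus ?thesis using hat_pos[of r acts 0] by (simp only: mult_le_cancel_right) auto
  qed
  have step: "pvar (hat acts k) (acts k) \<le> (\<Sum>j\<in>V. c ^ height V r pa j * ratio j * gain acts k j)"
    if k: "k < n" for k
  proof -
    have aL: "acts k \<in> L" and aV: "acts k \<in> V" using acts[OF k] L_sub by auto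
    \<comment> \<open>At the pulled leaf the path has length 0 and \<open>P = 1\<close>: one
      observation adds exactly \<open>1 / s\<^sup>2\<close> to its precision.\<close>
    have "1 * pvar (hat acts k) (acts k)
       \<le> (\<Sum>j\<in>anc r pa (acts k). c ^ height V r pa j * ratio j * gain acts k j)"
      by (rule scaled_pvar_le[where l = 0, OF c1 c[OF k] aL aV])
         (use aL in \<open>auto simp: hat_eq obsprec_def cnt_Suc add_divide_distrib\<close>)
    also have "\<dots> \<le> (\<Sum>j\<in>V. c ^ height V r pa j * ratio j * gain acts k j)"
      using anc_V[OF aV] c0 gain_nonneg by (intro sum_mono2) auto
    finally show ?thesis by simp
  qed
  have tel: "(\<Sum>k<n. gain acts k j) = ln (hat acts n j / hat acts 0 j)" if "j \<in> V" for j
  proof -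
    have [simp]: "hat acts k j \<noteq> 0" for k using hat_pos[OF that, of acts k] by simp
    show ?thesis by (induction n) (simp_all add: gain_def ln_div)
  qed
  \<comment> \<open>At the start the precision of \<open>j\<close> is
    \<open>1 / (s0 j)\<^sup>2\<close>. At the end a leaf has at most \<open>n\<close> observations,
    and the message of a child \<open>l\<close> is at most \<open>1 / (s0 l)\<^sup>2\<close>; this
    gives the arguments of the logarithms in the weights.\<close>
  have wgt: "ratio j * ln (hat acts n j / hat acts 0 j) \<le> wgt V r pa s0 s n j" if j: "j \<in> V" for j
  proof -
    let ?b = "if j \<in> L then 1 + (s0 j)\<^sup>2 * real n / s\<^sup>2 else 1 + (s0 j)\<^sup>2 * (\<Sum>l\<in>C j. 1 / (s0 l)\<^sup>2)"
    have s0: "0 < s0 j" using s0_pos j by auto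
    have "(\<Sum>l\<in>C j. tp acts n l) \<le> (\<Sum>l\<in>C j. 1 / (s0 l)\<^sup>2)"
      using C_sub by (intro sum_mono tp_le) auto
    moreover have "real (cnt acts n j) / s\<^sup>2 \<le> real n / s\<^sup>2"
      using cnt_le[of acts n j] by (simp add: divide_right_mono)
    ultimately have "hat acts n j \<le> 1 / (s0 j)\<^sup>2
        + (if j \<in> L then real n / s\<^sup>2 else \<Sum>l\<in>C j. 1 / (s0 l)\<^sup>2)"
      by (auto simp: hat_eq obsprec_def)
    from mult_left_mono[OF this, of "(s0 j)\<^sup>2"] s0
    have "(s0 j)\<^sup>2 * hat acts n j \<le> ?b"
      by (simp add: distrib_left split: if_splits)
    hence "hat acts n j / hat acts 0 j \<le> ?b"
      by (simp add: hat_0[OF j] mult.commute)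
    hence "ln (hat acts n j / hat acts 0 j) \<le> ln ?b"
      using hat_pos[OF j] by (intro ln_mono) auto
    thus ?thesis unfolding wgt_def ratio_def[symmetric]
      by (intro mult_left_mono) (use j in \<open>auto split: if_splits\<close>)
  qed
  have "(\<Sum>k<n. pvar (hat acts k) (acts k))
     \<le> (\<Sum>k<n. \<Sum>j\<in>V. c ^ height V r pa j * ratio j * gain acts k j)"
    by (rule sum_mono) (use step in auto)
  also have "\<dots> = (\<Sum>j\<in>V. \<Sum>k<n. c ^ height V r pa j * ratio j * gain acts k j)"
    by (rule sum.swap)
  also have "\<dots> = (\<Sum>j\<in>V. c ^ height V r pa j * (ratio j * ln (hat acts n j / hat acts 0 j)))"
    by (intro sum.cong refl) (simp add: sum_distrib_left[symmetric] tel mult_ac)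
  also have "\<dots> \<le> G V r pa s0 s c n"
    unfolding G_def using c0 wgt by (intro sum_mono mult_left_mono) auto
  finally show ?thesis .
qed

end

section \<open>Gaussian elimination on the tree\<close>

text \<open>Completion of the square in \<open>u\<close>. A node with parent value \<open>x\<close>
  and a log-quadratic weight splits into its conditional normal law, of precision \<open>h\<close>,
  and a weight in \<open>x\<close> that is again log-quadratic, with the message of
  \<open>tp_eq\<close> as quadratic coefficient. This closure property lets elimination be
  iterated.\<close>

lemma normal_density_tilt:
  fixes \<tau> S b x u :: real
  assumes \<tau>: "\<tau> > 0" and S: "S \<ge> 0" and h: "h = 1 / \<tau>\<^sup>2 + S"
  shows "normal_density 0 \<tau> (u - x) * exp (b * u - S * u\<^sup>2 / 2) =
    exp (b\<^sup>2 / (2 * h)) / (\<tau> * sqrt h) * exp (b / (\<tau>\<^sup>2 * h) * x - (1 / \<tau>\<^sup>2 - 1 / (\<tau>^4 * h)) * x\<^sup>2 / 2)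
      * normal_density (x / (\<tau>\<^sup>2 * h) + b / h) (1 / sqrt h) u"
proof -
  define g where "g = 1 / \<tau>\<^sup>2"
  have g: "g > 0" using \<tau> by (simp add: g_def)
  have h0: "h > 0" using g S h unfolding g_def by linarith
  have c: "1 / sqrt (2 * pi * \<tau>\<^sup>2) = 1 / (\<tau> * sqrt h) * (1 / sqrt (2 * pi * (1 / sqrt h)\<^sup>2))"
    using \<tau> h0 by (simp add: real_sqrt_mult real_sqrt_divide power_divide)
  have t4: "1 / (\<tau>^4 * h) = g\<^sup>2 / h"
    using \<tau> by (simp add: g_def field_simps power4_eq_xxxx power2_eq_square)
  have e: "- (u - x)\<^sup>2 * (g / 2) + (b * u - S * u\<^sup>2 / 2)
    = b\<^sup>2 / (2 * h) + (b * g / h * x - (g - g\<^sup>2 / h) * x\<^sup>2 / 2) + (- (u - (g * x + b) / h)\<^sup>2 * (h / 2))"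
  proof -
    have S: "S = h - g" using h by (simp add: g_def)
    show ?thesis unfolding S using h0 by (simp add: field_simps power2_eq_square)
  qed
  have 1: "- (u - x - 0)\<^sup>2 / (2 * \<tau>\<^sup>2) = - (u - x)\<^sup>2 * (g / 2)"
    by (simp add: g_def)
  have 2: "- (u - (x / (\<tau>\<^sup>2 * h) + b / h))\<^sup>2 / (2 * (1 / sqrt h)\<^sup>2) = - (u - (g * x + b) / h)\<^sup>2 * (h / 2)"
    using h0 by (simp add: g_def power_divide add_divide_distrib)
  have 3: "b / (\<tau>\<^sup>2 * h) * x - (1 / \<tau>\<^sup>2 - 1 / (\<tau>^4 * h)) * x\<^sup>2 / 2 = b * g / h * x - (g - g\<^sup>2 / h) * x\<^sup>2 / 2"
    unfolding t4 by (simp add: g_def)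
  have gen: "(1 / y * k) * P * Q = A / y * B * (k * D)" if "P * Q = A * B * D" for y k P Q A B D :: real
  proof -
    have "(1 / y * k) * P * Q = k / y * (P * Q)" by simp
    thus ?thesis by (simp add: that)
  qed
  show ?thesis
    unfolding normal_density_def 1 2 3 c
    by (rule gen) (simp only: exp_add[symmetric] e)
qed

text \<open>The substitution \<open>u = x + z\<close> passes from the increment to the node value. A
  test function \<open>f\<close> is carried along so that the conditional law of the node is
  retained, not only the total mass.\<close>

lemma nn_integral_normal_tilt:
  fixes \<tau> S b x :: real and f :: "real \<Rightarrow> ennreal"
  assumes \<tau>: "\<tau> > 0" and S: "S \<ge> 0" and h: "h = 1 / \<tau>\<^sup>2 + S"
    and f [measurable]: "f \<in> borel_measurable borel"
  shows "(\<integral>\<^sup>+z. ennreal (exp (b * (x + z) - S * (x + z)\<^sup>2 / 2)) * f (x + z)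
            \<partial>density lborel (normal_density 0 \<tau>)) =
    ennreal (exp (b\<^sup>2 / (2 * h)) / (\<tau> * sqrt h) *
      exp (b / (\<tau>\<^sup>2 * h) * x - (1 / \<tau>\<^sup>2 - 1 / (\<tau>^4 * h)) * x\<^sup>2 / 2)) *
      (\<integral>\<^sup>+u. f u * ennreal (normal_density (x / (\<tau>\<^sup>2 * h) + b / h) (1 / sqrt h) u) \<partial>lborel)"
proof -
  have h0: "h > 0" using \<tau> S h by (simp add: add_pos_nonneg)
  have "(\<integral>\<^sup>+z. ennreal (exp (b * (x + z) - S * (x + z)\<^sup>2 / 2)) * f (x + z)
            \<partial>density lborel (normal_density 0 \<tau>))
    = (\<integral>\<^sup>+z. ennreal (normal_density 0 \<tau> z * exp (b * (x + z) - S * (x + z)\<^sup>2 / 2)) * f (x + z) \<partial>lborel)"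
    by (subst nn_integral_density) (auto simp: ennreal_mult' mult.assoc)
  also have "\<dots> = (\<integral>\<^sup>+u. ennreal (normal_density 0 \<tau> (u - x) * exp (b * u - S * u\<^sup>2 / 2)) * f u \<partial>lborel)"
    by (subst (2) nn_integral_real_affine[of _ 1 x]) (auto simp: add.commute)
  also have "\<dots> = (\<integral>\<^sup>+u. ennreal (exp (b\<^sup>2 / (2 * h)) / (\<tau> * sqrt h) *
      exp (b / (\<tau>\<^sup>2 * h) * x - (1 / \<tau>\<^sup>2 - 1 / (\<tau>^4 * h)) * x\<^sup>2 / 2)) *
      (f u * ennreal (normal_density (x / (\<tau>\<^sup>2 * h) + b / h) (1 / sqrt h) u)) \<partial>lborel)"
    unfolding normal_density_tilt[OF \<tau> S h]
    by (intro nn_integral_cong, subst ennreal_mult'', simp) (simp only: mult_ac)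
  also have "\<dots> = ennreal (exp (b\<^sup>2 / (2 * h)) / (\<tau> * sqrt h) *
      exp (b / (\<tau>\<^sup>2 * h) * x - (1 / \<tau>\<^sup>2 - 1 / (\<tau>^4 * h)) * x\<^sup>2 / 2)) *
      (\<integral>\<^sup>+u. f u * ennreal (normal_density (x / (\<tau>\<^sup>2 * h) + b / h) (1 / sqrt h) u) \<partial>lborel)"
    by (subst nn_integral_cmult) auto
  finally show ?thesis .
qed

text \<open>The substitution \<open>y = \<alpha> * (x - m)\<close> turns the integral into a
  convolution of two centred normal densities. This is one step of the law of total variance, with
  \<open>\<alpha>\<close> the coefficient of the parent's value.\<close>

lemma normal_density_mixture:
  fixes \<alpha> \<beta> \<sigma> \<tau> m u :: real
  assumes "\<alpha> > 0" "\<sigma> > 0" "\<tau> > 0"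
  shows "(\<integral>\<^sup>+x. ennreal (normal_density (\<alpha> * x + \<beta>) \<sigma> u) * ennreal (normal_density m \<tau> x) \<partial>lborel)
    = ennreal (normal_density (\<alpha> * m + \<beta>) (sqrt (\<sigma>\<^sup>2 + \<alpha>\<^sup>2 * \<tau>\<^sup>2)) u)"
proof -
  have meas: "(\<lambda>x. normal_density (\<alpha> * x + \<beta>) \<sigma> u) \<in> borel_measurable borel"
    unfolding normal_density_def by measurable
  have 1: "normal_density (\<alpha> * (m + 1 / \<alpha> * y) + \<beta>) \<sigma> u = normal_density 0 \<sigma> ((u - (\<alpha> * m + \<beta>)) - y)" for y
    using assms by (simp add: normal_density_def algebra_simps)
  have 2: "normal_density m \<tau> (m + 1 / \<alpha> * y) = \<alpha> * normal_density 0 (\<alpha> * \<tau>) y" for y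
    using assms by (simp add: normal_density_def power_mult_distrib power_divide real_sqrt_mult mult_ac)
  have "(\<integral>\<^sup>+x. ennreal (normal_density (\<alpha> * x + \<beta>) \<sigma> u) * ennreal (normal_density m \<tau> x) \<partial>lborel)
    = ennreal (1 / \<alpha>) * (\<integral>\<^sup>+y. ennreal (normal_density 0 \<sigma> ((u - (\<alpha> * m + \<beta>)) - y)) *
        ennreal (\<alpha> * normal_density 0 (\<alpha> * \<tau>) y) \<partial>lborel)"
    using assms meas
    by (subst nn_integral_real_affine[of _ "1 / \<alpha>" m]) (auto simp: 1[simplified] 2[simplified])
  also have "\<dots> = (\<integral>\<^sup>+y. ennreal (normal_density 0 \<sigma> ((u - (\<alpha> * m + \<beta>)) - y) * normal_density 0 (\<alpha> * \<tau>) y) \<partial>lborel)"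
    using assms
    by (subst nn_integral_cmult[symmetric])
       (auto simp: ennreal_mult'[symmetric] mult_ac intro!: nn_integral_cong)
  also have "\<dots> = ennreal (normal_density 0 (sqrt (\<sigma>\<^sup>2 + (\<alpha> * \<tau>)\<^sup>2)) (u - (\<alpha> * m + \<beta>)))"
    using fun_cong[OF conv_normal_density_zero_mean[of \<sigma> "\<alpha> * \<tau>"], of "u - (\<alpha> * m + \<beta>)"] assms
    by simp
  also have "\<dots> = ennreal (normal_density (\<alpha> * m + \<beta>) (sqrt (\<sigma>\<^sup>2 + \<alpha>\<^sup>2 * \<tau>\<^sup>2)) u)"
    by (simp add: normal_density_def power_mult_distrib)
  finally show ?thesis .
qed

lemma nn_integral_normal_density [simp]:
  "\<sigma> > 0 \<Longrightarrow> (\<integral>\<^sup>+u. ennreal (normal_density m \<sigma> u) \<partial>lborel) = 1"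
  using prob_space.emeasure_space_1[OF prob_space_normal_density[of \<sigma> m]]
  by (simp add: emeasure_density)

section \<open>Eliminating the nodes of the tree by integration\<close>

context gauss_tree
begin

definition node :: "('v \<Rightarrow> real) \<Rightarrow> 'v \<Rightarrow> real" where
  "node Z i = mu + (\<Sum>j\<in>anc r pa i. Z j)"

text \<open>Outside \<open>V\<close> the sign of \<open>s0\<close> is unknown; the standard
  deviation 1 there makes every factor a probability measure, as a product family indexed by the
  whole type requires.\<close>

definition incr :: "'v \<Rightarrow> real measure" where
  "incr j = density lborel (normal_density 0 (if j \<in> V then s0 j else 1))"

lemma sets_incr [simp, measurable_cong]: "sets (incr j) = sets borel"
  by (simp add: incr_def)

lemma prob_incr: "prob_space (incr j)"
  unfolding incr_def by (rule prob_space_normal_density) (simp add: s0_pos)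

sublocale incr: product_sigma_finite incr
  unfolding product_sigma_finite_def
  by (intro allI prob_space_imp_sigma_finite prob_incr)

text \<open>The shape of what is left while deepest nodes are removed one by one: the value of a
  remaining node involves no removed increment.\<close>

definition anc_closed :: "'v set \<Rightarrow> bool" where
  "anc_closed W \<longleftrightarrow> W \<subseteq> V \<and> r \<in> W \<and> (\<forall>i\<in>W. i \<noteq> r \<longrightarrow> pa i \<in> W)"

lemma anc_closedD: assumes "anc_closed W" "i \<in> W" shows "anc r pa i \<subseteq> W"
proof -
  have "i \<in> V" using assms by (auto simp: anc_closed_def)
  thus ?thesis using assms
    by (induction rule: tree_induct) (auto simp: anc_closed_def anc_step)
qed

lemma node_measurable:
  assumes "anc_closed W" "i \<in> W" shows "(\<lambda>Z. node Z i) \<in> borel_measurable (PiM W incr)"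
proof -
  have "(\<lambda>Z. Z j) \<in> borel_measurable (PiM W incr)" if "j \<in> anc r pa i" for j
  proof -
    have "(\<lambda>Z. Z j) \<in> measurable (PiM W incr) (incr j)"
      using anc_closedD[OF assms] that by (intro measurable_component_singleton) auto
    thus ?thesis by (simp cong: measurable_cong_sets)
  qed
  thus ?thesis unfolding node_def by (intro borel_measurable_add borel_measurable_sum) auto
qed

text \<open>
  Integrating out a deepest node \<open>j\<close> of \<open>W\<close> leaves a Gaussian factor in the value of \<open>pa j\<close>,
  which is absorbed into \<open>S (pa j)\<close> and \<open>b (pa j)\<close>, so that the hypothesis on \<open>H\<close> persists.
\<close>

lemma tilted_marginal_normal:
  fixes S b H :: "'v \<Rightarrow> real"
  assumes "anc_closed W" "\<And>i. i \<in> W \<Longrightarrow> 0 \<le> S i" "\<And>i. i \<in> W \<Longrightarrow> 0 < H i"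
    "\<And>i. i \<in> W \<Longrightarrow> H i = 1 / (s0 i)\<^sup>2 + S i +
        (\<Sum>j\<in>{j\<in>W - {r}. pa j = i}. 1 / (s0 j)\<^sup>2 - 1 / ((s0 j)^4 * H j))"
  shows "\<exists>K m. 0 < K \<and> (\<forall>i\<in>W. \<forall>f\<in>borel_measurable borel.
    (\<integral>\<^sup>+Z. ennreal (exp (\<Sum>i\<in>W. b i * node Z i - S i * (node Z i)\<^sup>2 / 2)) * f (node Z i) \<partial>PiM W incr)
     = ennreal K * (\<integral>\<^sup>+x. f x * ennreal (normal_density (m i) (sqrt (pvar H i)) x) \<partial>lborel))"
  using assms
proof (induction "card W" arbitrary: W S b)
  case 0
  thus ?case using finite_subset[OF _ finite_V, of W] by (auto simp: anc_closed_def)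
next
  case (Suc N)
  have WV: "W \<subseteq> V" and rW: "r \<in> W" and paW: "\<And>i. i \<in> W \<Longrightarrow> i \<noteq> r \<Longrightarrow> pa i \<in> W"
    using Suc.prems(1) by (auto simp: anc_closed_def)
  have finW: "finite W" using WV finite_V finite_subset by blast
  show ?case
  proof (cases "W = {r}")
    \<comment> \<open>When only the root is left, its value is \<open>mu\<close> plus its own
      increment, so \<open>mu\<close> takes the place of a parent value.\<close>
    case True
    have s0: "0 < s0 r" by (simp add: s0_pos)
    have no: "{j\<in>W - {r}. pa j = r} = {}" using True by auto
    have H: "H r = 1 / (s0 r)\<^sup>2 + S r" using Suc.prems(4)[OF rW] unfolding no by simp
    have S: "0 \<le> S r" and Hp: "0 < H r" using Suc.prems(2,3)[OF rW] .
    let ?K = "exp ((b r)\<^sup>2 / (2 * H r)) / (s0 r * sqrt (H r)) *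
      exp (b r / ((s0 r)\<^sup>2 * H r) * mu - (1 / (s0 r)\<^sup>2 - 1 / ((s0 r)^4 * H r)) * mu\<^sup>2 / 2)"
    let ?m = "mu / ((s0 r)\<^sup>2 * H r) + b r / H r"
    have "(\<integral>\<^sup>+Z. ennreal (exp (\<Sum>i\<in>W. b i * node Z i - S i * (node Z i)\<^sup>2 / 2)) * f (node Z r) \<partial>PiM W incr)
       = ennreal ?K * (\<integral>\<^sup>+x. f x * ennreal (normal_density ?m (sqrt (pvar H r)) x) \<partial>lborel)"
      if f [measurable]: "f \<in> borel_measurable borel" for f :: "real \<Rightarrow> ennreal"
    proof -
      let ?g = "\<lambda>z. ennreal (exp (b r * (mu + z) - S r * (mu + z)\<^sup>2 / 2)) * f (mu + z)"
      have "(\<integral>\<^sup>+Z. ennreal (exp (\<Sum>i\<in>W. b i * node Z i - S i * (node Z i)\<^sup>2 / 2)) * f (node Z r) \<partial>PiM W incr)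
        = (\<integral>\<^sup>+Z. ?g (Z r) \<partial>PiM {r} incr)"
        by (simp add: True node_def)
      also have "\<dots> = integral\<^sup>N (incr r) ?g"
        by (rule incr.product_nn_integral_singleton) simp
      also have "\<dots> = ennreal ?K * (\<integral>\<^sup>+x. f x * ennreal (normal_density ?m (1 / sqrt (H r)) x) \<partial>lborel)"
        unfolding incr_def by (simp only: r_V if_True nn_integral_normal_tilt[OF s0 S H f])
      finally show ?thesis by (simp add: pvar_r real_sqrt_divide)
    qed
    moreover have "0 < ?K" using s0 Hp by simp
    ultimately show ?thesis
      by (intro exI[of _ ?K] exI[of _ "\<lambda>_. ?m"]) (simp add: True)
  next
    case False
    \<comment> \<open>A deepest node has no children in \<open>W\<close>, so among the nodes of
      \<open>W\<close> its increment occurs in its own value only.\<close>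
    obtain j where j: "j \<in> W" "j \<noteq> r" and jmax: "\<And>i. i \<in> W \<Longrightarrow> depth i \<le> depth j"
    proof -
      obtain j where j: "j \<in> W" "depth j = Max (depth ` W)"
      proof -
        have "Max (depth ` W) \<in> depth ` W" using finW rW by (intro Max_in) auto
        thus ?thesis using that by auto
      qed
      have mx: "depth i \<le> depth j" if "i \<in> W" for i using that finW j by simp
      obtain i where i: "i \<in> W" "i \<noteq> r" using False rW by auto
      have "depth i > 0" using i WV depth_pa[of i] by auto
      hence "j \<noteq> r" using mx[OF i(1)] by auto
      thus ?thesis using that j(1) mx by blast
    qed
    have jV: "j \<in> V" using j WV by auto
    define W' where "W' = W - {j}"
    have W: "W = insert j W'" "j \<notin> W'" and finW': "finite W'" using j finW by (auto simp: W'_def)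
    have noch: "pa i \<noteq> j" if "i \<in> W" "i \<noteq> r" for i
    proof
      assume "pa i = j"
      with depth_pa[of i] that WV have "depth i = Suc (depth j)" by blast
      thus False using jmax[OF that(1)] by simp
    qed
    have acl: "anc_closed W'"
      using Suc.prems(1) j noch by (auto simp: anc_closed_def W'_def)
    have pj: "pa j \<in> W'" using paW[OF j] noch[OF j] by (simp add: W'_def)
    \<comment> \<open>Quadratic and linear coefficients of the weight in the parent's value that
      remains when \<open>j\<close> is integrated out.\<close>
    let ?t = "1 / (s0 j)\<^sup>2 - 1 / ((s0 j)^4 * H j)"
    let ?bt = "b j / ((s0 j)\<^sup>2 * H j)"
    define S' where "S' = S(pa j := S (pa j) + ?t)"
    define b' where "b' = b(pa j := b (pa j) + ?bt)"
    have s0: "0 < s0 j" using s0_pos jV by simp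
    have no: "{l\<in>W - {r}. pa l = j} = {}" using noch by auto
    have Hj: "H j = 1 / (s0 j)\<^sup>2 + S j" using Suc.prems(4)[OF j(1)] unfolding no by simp
    have Sj: "0 \<le> S j" and Hp: "0 < H j" using Suc.prems(2,3)[OF j(1)] .
    have t0: "0 \<le> ?t"
    proof -
      have "1 / (s0 j)\<^sup>2 \<le> H j" using Hj Sj by simp
      hence "1 \<le> (s0 j)\<^sup>2 * H j" using s0 by (simp add: field_simps)
      moreover have "(s0 j)^4 * H j = (s0 j)\<^sup>2 * ((s0 j)\<^sup>2 * H j)"
        by (simp add: power4_eq_xxxx power2_eq_square)
      ultimately have "(s0 j)\<^sup>2 \<le> (s0 j)^4 * H j"
        using mult_left_mono[of 1 "(s0 j)\<^sup>2 * H j" "(s0 j)\<^sup>2"] by simp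
      thus ?thesis using s0 by (simp add: frac_le)
    qed
    have IHS: "0 \<le> S' i" if "i \<in> W'" for i
      using Suc.prems(2) t0 that pj W by (auto simp: S'_def)
    have IHH: "H i = 1 / (s0 i)\<^sup>2 + S' i +
        (\<Sum>l\<in>{l\<in>W' - {r}. pa l = i}. 1 / (s0 l)\<^sup>2 - 1 / ((s0 l)^4 * H l))" if i: "i \<in> W'" for i
    proof -
      have "{l\<in>W - {r}. pa l = i} = (if i = pa j then insert j {l\<in>W' - {r}. pa l = i} else {l\<in>W' - {r}. pa l = i})"
        using j W by auto
      moreover have nin: "j \<notin> {l\<in>W' - {r}. pa l = i}" and fin: "finite {l\<in>W' - {r}. pa l = i}"
        using W finW' by auto
      moreover have "i \<in> W" using i W by blast
      from Suc.prems(4)[OF this] have "H i = 1 / (s0 i)\<^sup>2 + S i +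
        (\<Sum>j\<in>{j\<in>W - {r}. pa j = i}. 1 / (s0 j)\<^sup>2 - 1 / ((s0 j)^4 * H j))" .
      ultimately show ?thesis
      proof (cases "i = pa j")
        case True
        show ?thesis
          using \<open>H i = _\<close> \<open>{j\<in>W - {r}. pa j = i} = _\<close> sum.insert[OF fin nin, of "\<lambda>l. 1 / (s0 l)\<^sup>2 - 1 / ((s0 l)^4 * H l)"]
          unfolding True by (simp only: S'_def if_True refl fun_upd_same add_ac)
      next
        case False
        show ?thesis
          using \<open>H i = _\<close> \<open>{j\<in>W - {r}. pa j = i} = _\<close> False by (simp add: S'_def)
      qed
    qed
    have "N = card W'" using Suc.hyps(2) W finW' by simp
    from Suc.hyps(1)[OF this acl IHS _ IHH, of b'] Suc.prems(3) W
    obtain K m where K: "0 < K" and IH: "\<And>i f. i \<in> W' \<Longrightarrow> f \<in> borel_measurable borel \<Longrightarrow>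
        (\<integral>\<^sup>+Z. ennreal (exp (\<Sum>i\<in>W'. b' i * node Z i - S' i * (node Z i)\<^sup>2 / 2)) * f (node Z i) \<partial>PiM W' incr)
       = ennreal K * (\<integral>\<^sup>+x. f x * ennreal (normal_density (m i) (sqrt (pvar H i)) x) \<partial>lborel)"
      by auto
    let ?k = "exp ((b j)\<^sup>2 / (2 * H j)) / (s0 j * sqrt (H j))"
    have k0: "0 < ?k" using s0 Hp by simp
    let ?al = "1 / (H j * (s0 j)\<^sup>2)" and ?be = "b j / H j"
    have al: "0 < ?al" using s0 Hp by simp
    define w where "w Z = exp (\<Sum>i\<in>W. b i * node Z i - S i * (node Z i)\<^sup>2 / 2)" for Z
    define w' where "w' Z = exp (\<Sum>i\<in>W'. b i * node Z i - S i * (node Z i)\<^sup>2 / 2)" for Z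
    define w'' where "w'' Z = exp (\<Sum>i\<in>W'. b' i * node Z i - S' i * (node Z i)\<^sup>2 / 2)" for Z
    have node1: "node (Z(j := z)) i = node Z i" if "i \<in> W'" for Z z i
      unfolding node_def using anc_closedD[OF acl that] W(2)
      by (intro arg_cong2[where f="(+)"] refl sum.cong) auto
    have node2: "node (Z(j := z)) j = node Z (pa j) + z" for Z z
    proof -
      have "(\<Sum>l\<in>anc r pa (pa j). (Z(j := z)) l) = (\<Sum>l\<in>anc r pa (pa j). Z l)"
        using anc_closedD[OF acl pj] W(2) by (intro sum.cong) auto
      thus ?thesis unfolding node_def sum_anc[OF jV j(2)] by simp
    qed
    have wup: "w (Z(j := z)) = w' Z * exp (b j * (node Z (pa j) + z) - S j * (node Z (pa j) + z)\<^sup>2 / 2)"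
      for Z z
    proof -
      have "(\<Sum>i\<in>W'. b i * node (Z(j := z)) i - S i * (node (Z(j := z)) i)\<^sup>2 / 2)
         = (\<Sum>i\<in>W'. b i * node Z i - S i * (node Z i)\<^sup>2 / 2)"
        by (intro sum.cong refl) (simp add: node1)
      thus ?thesis unfolding w_def w'_def W(1) using W(2) finW'
        by (simp add: node2 exp_add[symmetric] add.commute)
    qed
    have w'': "w' Z * exp (?bt * node Z (pa j) - ?t * (node Z (pa j))\<^sup>2 / 2) = w'' Z" for Z
    proof -
      let ?q = "\<lambda>b S i. b i * node Z i - S i * (node Z i)\<^sup>2 / 2"
      have "(\<Sum>i\<in>W'. ?q b' S' i) = ?q b' S' (pa j) + (\<Sum>i\<in>W' - {pa j}. ?q b' S' i)"
        using finW' pj by (rule sum.remove)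
      moreover have "(\<Sum>i\<in>W'. ?q b S i) = ?q b S (pa j) + (\<Sum>i\<in>W' - {pa j}. ?q b S i)"
        using finW' pj by (rule sum.remove)
      moreover have "(\<Sum>i\<in>W' - {pa j}. ?q b' S' i) = (\<Sum>i\<in>W' - {pa j}. ?q b S i)"
        by (intro sum.cong) (auto simp: b'_def S'_def)
      moreover have "?q b' S' (pa j) = ?q b S (pa j) + (?bt * node Z (pa j) - ?t * (node Z (pa j))\<^sup>2 / 2)"
        by (simp add: b'_def S'_def distrib_right add_divide_distrib)
      ultimately show ?thesis unfolding w'_def w''_def exp_add[symmetric] by simp
    qed
    have meas: "(\<lambda>Z. node Z i) \<in> borel_measurable (PiM W incr)" if "i \<in> W" for i
      by (rule node_measurable[OF Suc.prems(1) that])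
    have meas' [measurable]: "(\<lambda>Z. node Z i) \<in> borel_measurable (PiM W' incr)" if "i \<in> W'" for i
      by (rule node_measurable[OF acl that])
    have w''_meas: "w'' \<in> borel_measurable (PiM W' incr)"
      unfolding w''_def by measurable
    have w_meas: "w \<in> borel_measurable (PiM W incr)"
      unfolding w_def using meas by measurable
    let ?F = "\<lambda>f x. \<integral>\<^sup>+u. f u * ennreal (normal_density (?al * x + ?be) (1 / sqrt (H j)) u) \<partial>lborel"
    \<comment> \<open>One computation for two purposes: for a node other than \<open>j\<close>,
      \<open>g\<close> carries the test function and \<open>f\<close> is 1; for \<open>j\<close>
      itself the roles are exchanged.\<close>
    have split: "(\<integral>\<^sup>+Z. ennreal (w Z) * (g Z * f (node Z j)) \<partial>PiM W incr)
        = ennreal ?k * (\<integral>\<^sup>+Z. ennreal (w'' Z) * (g Z * ?F f (node Z (pa j))) \<partial>PiM W' incr)"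
      if [measurable]: "f \<in> borel_measurable borel"
        and g: "\<And>Z z. g (Z(j := z)) = g Z" and gm: "g \<in> borel_measurable (PiM W incr)"
        and gm': "g \<in> borel_measurable (PiM W' incr)"
        for f :: "real \<Rightarrow> ennreal" and g :: "('v \<Rightarrow> real) \<Rightarrow> ennreal"
    proof -
      have m1: "(\<lambda>Z. ennreal (w Z) * (g Z * f (node Z j))) \<in> borel_measurable (PiM (insert j W') incr)"
        using w_meas gm meas[OF j(1)] unfolding W(1)[symmetric] by measurable
      have "(\<integral>\<^sup>+Z. ennreal (w Z) * (g Z * f (node Z j)) \<partial>PiM W incr)
        = (\<integral>\<^sup>+Z. (\<integral>\<^sup>+z. ennreal (w (Z(j := z))) * (g (Z(j := z)) * f (node (Z(j := z)) j)) \<partial>incr j) \<partial>PiM W' incr)"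
        using incr.product_nn_integral_insert[OF finW' W(2) m1] unfolding W(1) .
      also have "\<dots> = (\<integral>\<^sup>+Z. ennreal ?k * (ennreal (w'' Z) * (g Z * ?F f (node Z (pa j)))) \<partial>PiM W' incr)"
      proof (intro nn_integral_cong)
        fix Z
        let ?x = "node Z (pa j)"
        let ?e = "\<lambda>z. ennreal (exp (b j * (?x + z) - S j * (?x + z)\<^sup>2 / 2))"
        have "(\<integral>\<^sup>+z. ennreal (w (Z(j := z))) * (g (Z(j := z)) * f (node (Z(j := z)) j)) \<partial>incr j)
           = (\<integral>\<^sup>+z. (ennreal (w' Z) * g Z) * (?e z * f (?x + z)) \<partial>incr j)"
          by (simp add: wup node2 g ennreal_mult' w'_def mult_ac)
        also have "\<dots> = (ennreal (w' Z) * g Z) * (\<integral>\<^sup>+z. ?e z * f (?x + z) \<partial>incr j)"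
          by (subst nn_integral_cmult) auto
        also have "(\<integral>\<^sup>+z. ?e z * f (?x + z) \<partial>incr j) = 
          ennreal (?k * exp (?bt * ?x - ?t * ?x\<^sup>2 / 2)) * 
            (\<integral>\<^sup>+u. f u * ennreal (normal_density (?x / ((s0 j)\<^sup>2 * H j) + b j / H j) (1 / sqrt (H j)) u) \<partial>lborel)"
          unfolding incr_def by (simp only: jV if_True nn_integral_normal_tilt[OF s0 Sj Hj that(1)])
        also have "?x / ((s0 j)\<^sup>2 * H j) + b j / H j = ?al * ?x + ?be" by (simp add: mult.commute)
        also have "(ennreal (w' Z) * g Z) * (ennreal (?k * exp (?bt * ?x - ?t * ?x\<^sup>2 / 2)) * ?F f ?x)
           = ennreal ?k * (ennreal (w' Z * exp (?bt * ?x - ?t * ?x\<^sup>2 / 2)) * (g Z * ?F f ?x))"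
          using k0 by (simp only: ennreal_mult' ennreal_mult'' less_imp_le exp_ge_zero mult_ac)
        finally show "(\<integral>\<^sup>+z. ennreal (w (Z(j := z))) * (g (Z(j := z)) * f (node (Z(j := z)) j)) \<partial>incr j)
          = ennreal ?k * (ennreal (w'' Z) * (g Z * ?F f ?x))" unfolding w'' .
      qed
      also have "\<dots> = ennreal ?k * (\<integral>\<^sup>+Z. ennreal (w'' Z) * (g Z * ?F f (node Z (pa j))) \<partial>PiM W' incr)"
      proof (rule nn_integral_cmult)
        have [measurable]: "?F f \<in> borel_measurable borel"
          unfolding normal_density_def by measurable
        show "(\<lambda>Z. ennreal (w'' Z) * (g Z * ?F f (node Z (pa j)))) \<in> borel_measurable (PiM W' incr)"
          using w''_meas gm' meas'[OF pj] by measurable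
      qed
      finally show ?thesis .
    qed
    have kK: "ennreal (?k * K) * X = ennreal ?k * (ennreal K * X)" for X
      using k0 K by (simp only: ennreal_mult less_imp_le mult.assoc)
    define m' where "m' = m(j := ?al * m (pa j) + ?be)"
    have "(\<integral>\<^sup>+Z. ennreal (w Z) * f (node Z i) \<partial>PiM W incr)
       = ennreal (?k * K) * (\<integral>\<^sup>+x. f x * ennreal (normal_density (m' i) (sqrt (pvar H i)) x) \<partial>lborel)"
      if i: "i \<in> W" and f [measurable]: "f \<in> borel_measurable borel" for f :: "real \<Rightarrow> ennreal" and i
    proof (cases "i = j")
      case False
      hence iW': "i \<in> W'" using i W by auto
      have s: "0 < 1 / sqrt (H j)" using Hp by simp
      have "(\<integral>\<^sup>+Z. ennreal (w Z) * (f (node Z i) * 1) \<partial>PiM W incr)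
        = ennreal ?k * (\<integral>\<^sup>+Z. ennreal (w'' Z) * (f (node Z i) * ?F (\<lambda>_. 1) (node Z (pa j))) \<partial>PiM W' incr)"
        by (rule split) (use meas[OF i] meas'[OF iW'] in \<open>auto simp: node1[OF iW']\<close>)
      also have "?F (\<lambda>_. 1) = (\<lambda>_. 1)" using nn_integral_normal_density[OF s] by auto
      finally show ?thesis unfolding kK using IH[OF iW' f] False
        by (simp add: w''_def m'_def)
    next
      case True
      have Fm: "?F f \<in> borel_measurable borel" unfolding normal_density_def by measurable
      have ndm: "(\<lambda>(x, u). normal_density (?al * x + ?be) (1 / sqrt (H j)) u) \<in> borel_measurable (borel \<Otimes>\<^sub>M borel)"
        unfolding normal_density_def by measurable
      have pp: "0 < pvar H (pa j)"
        using pj WV W Suc.prems(3) Suc.prems(1)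
      proof -
        have "0 < pvar H i" if "i \<in> V" "i \<in> W" for i
          using that
        proof (induction rule: tree_induct)
          case root thus ?case using Suc.prems(3) by (simp add: pvar_r)
        next
          case (step i) thus ?case
            using Suc.prems(3)[of i] paW[of i] by (auto simp: pvar_step intro!: add_pos_nonneg)
        qed
        thus ?thesis using pj WV W by auto
      qed
      have "(\<integral>\<^sup>+Z. ennreal (w Z) * (1 * f (node Z j)) \<partial>PiM W incr)
        = ennreal ?k * (\<integral>\<^sup>+Z. ennreal (w'' Z) * (1 * ?F f (node Z (pa j))) \<partial>PiM W' incr)"
        by (rule split) auto
      also have "\<dots> = ennreal ?k * (ennreal K * (\<integral>\<^sup>+x. ?F f x *
          ennreal (normal_density (m (pa j)) (sqrt (pvar H (pa j))) x) \<partial>lborel))"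
        using IH[OF pj Fm] by (simp add: w''_def)
      \<comment> \<open>The law of \<open>j\<close> is its conditional law mixed over the normal law
        of the parent. Exchanging the integrals makes this mixture explicit, and its variance is the
        recursion of \<open>pvar\<close>.\<close>
      also have "(\<integral>\<^sup>+x. ?F f x * ennreal (normal_density (m (pa j)) (sqrt (pvar H (pa j))) x) \<partial>lborel)
        = (\<integral>\<^sup>+x. \<integral>\<^sup>+u. f u * (ennreal (normal_density (?al * x + ?be) (1 / sqrt (H j)) u) *
            ennreal (normal_density (m (pa j)) (sqrt (pvar H (pa j))) x)) \<partial>lborel \<partial>lborel)"
        by (subst nn_integral_multc[symmetric]) (auto simp: mult_ac)
      also have "\<dots> = (\<integral>\<^sup>+u. \<integral>\<^sup>+x. f u * (ennreal (normal_density (?al * x + ?be) (1 / sqrt (H j)) u) *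
            ennreal (normal_density (m (pa j)) (sqrt (pvar H (pa j))) x)) \<partial>lborel \<partial>lborel)"
        by (rule lborel_pair.Fubini') (use ndm in measurable)
      also have "\<dots> = (\<integral>\<^sup>+u. f u * (\<integral>\<^sup>+x. ennreal (normal_density (?al * x + ?be) (1 / sqrt (H j)) u) *
            ennreal (normal_density (m (pa j)) (sqrt (pvar H (pa j))) x) \<partial>lborel) \<partial>lborel)"
        by (intro nn_integral_cong nn_integral_cmult) (use ndm in measurable)
      also have "\<dots> = (\<integral>\<^sup>+u. f u * ennreal (normal_density (?al * m (pa j) + ?be)
           (sqrt ((1 / sqrt (H j))\<^sup>2 + ?al\<^sup>2 * (sqrt (pvar H (pa j)))\<^sup>2)) u) \<partial>lborel)"
        by (subst normal_density_mixture) (use al Hp pp in auto)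
      also have "(1 / sqrt (H j))\<^sup>2 + ?al\<^sup>2 * (sqrt (pvar H (pa j)))\<^sup>2 = pvar H j"
        using jV j Hp pp by (subst pvar_step[OF jV j(2)]) (simp add: power_divide)
      finally show ?thesis unfolding kK using True
        by (simp add: m'_def)
    qed
    moreover have "0 < ?k * K" using k0 K by (rule mult_pos_pos)
    ultimately show ?thesis unfolding w_def by blast
  qed
qed

end

section \<open>The law of the bandit process\<close>

text \<open>Measurability of the mass of a fixed set is Tonelli's theorem. The criterion serves both
  the posterior and the observation of a reward.\<close>

lemma density_kernel:
  assumes M: "sigma_finite_measure M"
    and f [measurable]: "(\<lambda>(x, y). f x y) \<in> borel_measurable (N \<Otimes>\<^sub>M M)"
    and one: "\<And>x. x \<in> space N \<Longrightarrow> (\<integral>\<^sup>+y. f x y \<partial>M) = 1"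
  shows "(\<lambda>x. density M (f x)) \<in> N \<rightarrow>\<^sub>M prob_algebra M"
proof -
  interpret sigma_finite_measure M by (rule M)
  have fx: "f x \<in> borel_measurable M" if "x \<in> space N" for x
    using measurable_compose[OF measurable_Pair1'[OF that] f] by simp
  have prob: "prob_space (density M (f x))" if "x \<in> space N" for x
    by (rule prob_spaceI) (use one[OF that] fx[OF that] in \<open>simp add: emeasure_density cong: nn_integral_cong\<close>)
  show ?thesis
  proof (intro measurable_prob_algebraI prob measurable_subprob_algebra)
    show "subprob_space (density M (f x))" if "x \<in> space N" for x
      by (rule prob_space_imp_subprob_space[OF prob[OF that]])
    show "(\<lambda>x. emeasure (density M (f x)) A) \<in> borel_measurable N" if [measurable]: "A \<in> sets M" for A
    proof (subst measurable_cong)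
      show "emeasure (density M (f x)) A = (\<integral>\<^sup>+y. f x y * indicator A y \<partial>M)" if "x \<in> space N" for x
        using fx[OF that] by (simp add: emeasure_density)
      show "(\<lambda>x. \<integral>\<^sup>+y. f x y * indicator A y \<partial>M) \<in> borel_measurable N"
        by measurable
    qed
    show "sets (density M (f x)) = sets M" for x by (rule sets_density)
  qed
qed

text \<open>
  The target type may be uncountable, but the value depends only on the set of maximisers, which
  ranges over the finitely many subsets of \<open>S\<close>.
\<close>

lemma measurable_arg_max_on:
  fixes S :: "'a set" and M :: "'b measure" and f :: "'b \<Rightarrow> 'a \<Rightarrow> real"
  assumes S: "finite S" and f [measurable]: "\<And>a. a \<in> S \<Longrightarrow> (\<lambda>x. f x a) \<in> borel_measurable M"
  shows "(\<lambda>x. arg_max_on (f x) S) \<in> M \<rightarrow>\<^sub>M count_space UNIV"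
proof -
  define ms where "ms x = {a\<in>S. \<forall>b\<in>S. f x b \<le> f x a}" for x
  have eq: "(\<lambda>x. arg_max_on (f x) S) = (\<lambda>x. (\<lambda>T. SOME a. a \<in> T) (ms x))"
    unfolding arg_max_on_def arg_max_def is_arg_max_def ms_def
    by (intro ext arg_cong[where f = Eps]) (auto simp: not_less)
  have "ms \<in> M \<rightarrow>\<^sub>M count_space (Pow S)"
  proof (subst measurable_count_space_eq2, simp add: S, intro conjI ballI)
    show "ms \<in> space M \<rightarrow> Pow S" by (auto simp: ms_def)
    fix T assume T: "T \<in> Pow S"
    have "ms x = T \<longleftrightarrow> (\<forall>a\<in>S. (a \<in> T) \<longleftrightarrow> (\<forall>b\<in>S. f x b \<le> f x a))" for x
      using T unfolding ms_def by blast
    hence "ms -` {T} \<inter> space M = {x\<in>space M. \<forall>a\<in>S. (a \<in> T) \<longleftrightarrow> (\<forall>b\<in>S. f x b \<le> f x a)}"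
      by auto
    also have "\<dots> \<in> sets M" using S by measurable
    finally show "ms -` {T} \<inter> space M \<in> sets M" .
  qed
  thus ?thesis unfolding eq by (rule measurable_compose) simp
qed

lemma arg_max_on_in:
  fixes f :: "'a \<Rightarrow> real"
  assumes "finite S" "S \<noteq> {}"
  shows "arg_max_on f S \<in> S" "b \<in> S \<Longrightarrow> f b \<le> f (arg_max_on f S)"
proof -
  have "Max (f ` S) \<in> f ` S" using assms by (intro Max_in) auto
  then obtain a where a: "Max (f ` S) = f a" "a \<in> S" by (rule imageE)
  have "is_arg_max f (\<lambda>x. x \<in> S) a"
    using a Max_ge[of "f ` S"] assms by (auto simp: is_arg_max_def not_less)
  hence *: "is_arg_max f (\<lambda>x. x \<in> S) (arg_max_on f S)"
    unfolding arg_max_on_def arg_max_def by (rule someI)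
  show "arg_max_on f S \<in> S" using * by (simp add: is_arg_max_def)
  show "b \<in> S \<Longrightarrow> f b \<le> f (arg_max_on f S)" using * by (auto simp: is_arg_max_def not_less)
qed

lemma lik_pos: "s > 0 \<Longrightarrow> 0 < lik s k h th"
  by (simp add: lik_def prod_pos normal_density_pos)

lemma lik_upd: "lik s (Suc t) (h(t := (a, y))) th = lik s t h th * normal_density (th a) s y"
  by (simp add: lik_def)

lemma lik_le: "s > 0 \<Longrightarrow> lik s k h th \<le> (1 / sqrt (2 * pi * s\<^sup>2)) ^ k"
proof -
  assume s: "s > 0"
  have "lik s k h th \<le> (\<Prod>l<k. 1 / sqrt (2 * pi * s\<^sup>2))"
    unfolding lik_def
  proof (intro prod_mono conjI)
    fix l
    have "normal_density (th (fst (h l))) s (snd (h l)) \<le> 1 / sqrt (2 * pi * s\<^sup>2) * 1"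
      unfolding normal_density_def by (intro mult_left_mono) auto
    thus "normal_density (th (fst (h l))) s (snd (h l)) \<le> 1 / sqrt (2 * pi * s\<^sup>2)" by simp
  qed simp
  thus ?thesis by simp
qed

section \<open>The posterior and one round of the algorithm as probability kernels\<close>

context gauss_tree
begin

abbreviation "PM \<equiv> PiM V (\<lambda>_. borel :: real measure)"
abbreviation "P \<equiv> prior V r pa mu s0"
abbreviation HM :: "(nat \<Rightarrow> 'v \<times> real) measure" where
  "HM \<equiv> PiM UNIV (\<lambda>_. count_space UNIV \<Otimes>\<^sub>M borel)"
abbreviation "SM \<equiv> stateM V"
abbreviation "post \<equiv> posterior P s"
abbreviation act :: "('v \<Rightarrow> real) \<Rightarrow> 'v" where "act Th \<equiv> arg_max_on Th L"
abbreviation "law \<equiv> hts_law V r pa mu s0 s"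

lemma SM_eq: "SM = PM \<Otimes>\<^sub>M HM" by (simp add: stateM_def)

lemma space_HM [simp]: "space HM = UNIV"
  by (simp add: space_PiM space_pair_measure PiE_def extensional_def)

lemma prior_eq: "P = distr (PiM V incr) PM (\<lambda>Z. \<lambda>i\<in>V. node Z i)"
proof -
  have "(\<Pi>\<^sub>M j\<in>V. density lborel (normal_density 0 (s0 j))) = PiM V incr"
    by (intro PiM_cong) (auto simp: incr_def)
  thus ?thesis by (simp add: prior_def node_def[abs_def])
qed

lemma anc_closed_V: "anc_closed V" by (simp add: anc_closed_def)

lemma nodes_measurable [measurable]: "(\<lambda>Z. \<lambda>i\<in>V. node Z i) \<in> PiM V incr \<rightarrow>\<^sub>M PM"
  by (intro measurable_restrict) (auto intro: node_measurable anc_closed_V)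

lemma sets_P [simp, measurable_cong]: "sets P = sets PM"
  by (simp add: prior_eq)

lemma space_P [simp]: "space P = space PM"
  by (rule sets_eq_imp_space_eq) simp

lemma prob_P: "prob_space P"
  unfolding prior_eq by (rule prob_space.prob_space_distr[OF prob_space_PiM]) (auto simp: prob_incr)

lemma nn_integral_P:
  "f \<in> borel_measurable PM \<Longrightarrow> (\<integral>\<^sup>+th. f th \<partial>P) = (\<integral>\<^sup>+Z. f (\<lambda>i\<in>V. node Z i) \<partial>PiM V incr)"
  unfolding prior_eq by (rule nn_integral_distr) auto

text \<open>The index \<open>g x\<close> varies in an arbitrary type with the discrete
  sigma-algebra, possibly an uncountable one. Members of \<open>space PM\<close> are
  \<open>undefined\<close> outside the finite set \<open>V\<close>, which reduces the evaluation to
  finitely many coordinates and a constant.\<close>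

lemma param_measurable:
  assumes f: "f \<in> N \<rightarrow>\<^sub>M PM" and g [measurable]: "g \<in> N \<rightarrow>\<^sub>M count_space UNIV"
  shows "(\<lambda>x. f x (g x)) \<in> borel_measurable N"
proof (subst measurable_cong)
  fix x assume "x \<in> space N"
  hence "f x \<in> space PM" by (rule measurable_space[OF f])
  hence "f x i = undefined" if "i \<notin> V" for i using that by (auto simp: space_PiM)
  thus "f x (g x) = (\<Sum>i\<in>V. if g x = i then f x i else 0) + (if g x \<in> V then 0 else undefined)"
    by (auto simp: sum.delta)
next
  have [measurable]: "Measurable.pred N (\<lambda>x. g x \<in> V)"
    using measurable_compose[OF g, of "\<lambda>a. a \<in> V" "count_space UNIV"] by simp
  have [measurable]: "(\<lambda>x. f x i) \<in> borel_measurable N" if "i \<in> V" for i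
    using measurable_compose[OF f measurable_component_singleton[OF that]] .
  show "(\<lambda>x. (\<Sum>i\<in>V. if g x = i then f x i else 0) + (if g x \<in> V then 0 else undefined)) \<in> borel_measurable N"
    by measurable
qed

lemma hist_measurable [measurable]:
  "(\<lambda>h. h l) \<in> HM \<rightarrow>\<^sub>M count_space UNIV \<Otimes>\<^sub>M borel"
  by (rule measurable_component_singleton) simp

lemma normal_density_measurable:
  assumes [measurable]: "f \<in> borel_measurable N" "g \<in> borel_measurable N"
  shows "(\<lambda>x. normal_density (f x) s (g x)) \<in> borel_measurable N"
  unfolding normal_density_def by measurable

lemma lik_measurable:
  assumes [measurable]: "h \<in> N \<rightarrow>\<^sub>M HM" "th \<in> N \<rightarrow>\<^sub>M PM"
  shows "(\<lambda>x. lik s k (h x) (th x)) \<in> borel_measurable N"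
  unfolding lik_def
  by (intro borel_measurable_prod normal_density_measurable param_measurable[where f = th]) measurable

definition evid :: "nat \<Rightarrow> (nat \<Rightarrow> 'v \<times> real) \<Rightarrow> ennreal" where
  "evid k h = (\<integral>\<^sup>+th. ennreal (lik s k h th) \<partial>P)"

lemma lik_measurable1: "lik s k h \<in> borel_measurable PM"
  by (rule lik_measurable) auto

text \<open>Positivity here and finiteness below make the quotient in the posterior a genuine
  normalisation in the extended reals.\<close>

lemma evid_pos: "0 < evid k h" 
proof -
  interpret prob_space P by (rule prob_P)
  have "evid k h \<noteq> 0"
  proof
    assume "evid k h = 0"
    hence "AE th in P. ennreal (lik s k h th) = 0"
      unfolding evid_def using lik_measurable1 by (subst (asm) nn_integral_0_iff_AE) auto
    moreover have "ennreal (lik s k h th) \<noteq> 0" for th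
      using lik_pos[OF s_pos, of k h th] by simp
    ultimately show False by simp
  qed
  thus ?thesis by (simp add: zero_less_iff_neq_zero)
qed

lemma evid_fin: "evid k h < \<infinity>"
proof -
  interpret prob_space P by (rule prob_P)
  have "evid k h \<le> (\<integral>\<^sup>+th. ennreal ((1 / sqrt (2 * pi * s\<^sup>2)) ^ k) \<partial>P)"
    unfolding evid_def by (intro nn_integral_mono ennreal_leI lik_le s_pos)
  also have "\<dots> < \<infinity>" using emeasure_space_1 by (simp add: ennreal_mult_less_top)
  finally show ?thesis .
qed

lemma post_eq: "post k h = density P (\<lambda>th. ennreal (lik s k h th) / evid k h)"
  by (simp add: posterior_def evid_def)

lemma post_kernel [measurable]: "post k \<in> HM \<rightarrow>\<^sub>M prob_algebra PM"
proof -
  interpret prob_space P by (rule prob_P)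
  have lm [measurable]: "(\<lambda>(h, th). lik s k h th) \<in> borel_measurable (HM \<Otimes>\<^sub>M P)"
    using lik_measurable[of fst "HM \<Otimes>\<^sub>M P" snd k] by (simp add: split_beta' cong: measurable_cong_sets)
  have em [measurable]: "evid k \<in> borel_measurable HM"
    unfolding evid_def by measurable
  have "(\<lambda>h. density P (\<lambda>th. ennreal (lik s k h th) / evid k h)) \<in> HM \<rightarrow>\<^sub>M prob_algebra P"
  proof (rule density_kernel)
    show "sigma_finite_measure P" by unfold_locales
    show "(\<lambda>(h, th). ennreal (lik s k h th) / evid k h) \<in> borel_measurable (HM \<Otimes>\<^sub>M P)"
      by measurable
    show "(\<integral>\<^sup>+th. ennreal (lik s k h th) / evid k h \<partial>P) = 1" for h
      using evid_pos[of k h] evid_fin[of k h] lik_measurable1[of k h]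
      by (subst nn_integral_divide) (auto simp: evid_def[symmetric] ennreal_divide_self cong: measurable_cong_sets)
  qed
  moreover have "prob_algebra P = prob_algebra PM" 
    using subprob_algebra_cong[OF sets_P] by (simp add: prob_algebra_def)
  ultimately show ?thesis unfolding post_eq[abs_def] by simp
qed

lemma prob_post: "prob_space (post k h)" and sets_post [simp, measurable_cong]: "sets (post k h) = sets PM"
proof -
  have "post k h \<in> space (prob_algebra PM)"
    by (rule measurable_space[OF post_kernel]) simp
  thus "prob_space (post k h)" "sets (post k h) = sets PM" by (auto simp: space_prob_algebra)
qed

lemma space_post [simp]: "space (post k h) = space PM"
  by (rule sets_eq_imp_space_eq) simp

lemma nn_integral_post:
  assumes [measurable]: "f \<in> borel_measurable PM"
  shows "(\<integral>\<^sup>+th. f th \<partial>post k h) = (\<integral>\<^sup>+th. ennreal (lik s k h th) * f th \<partial>P) / evid k h"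
proof -
  have [measurable]: "lik s k h \<in> borel_measurable PM" by (rule lik_measurable1)
  show ?thesis
    unfolding post_eq
    by (subst nn_integral_density) (auto simp: nn_integral_divide[symmetric] ennreal_times_divide mult.commute)
qed

lemma act_measurable [measurable]: "act \<in> PM \<rightarrow>\<^sub>M count_space UNIV"
  by (rule measurable_arg_max_on) (use L_sub in auto)

lemma act_in_L [simp]: "act Th \<in> L"
  by (rule arg_max_on_in) (auto simp: leaves_nonempty)

lemma upd_measurable:
  assumes [measurable]: "h \<in> N \<rightarrow>\<^sub>M HM" "a \<in> N \<rightarrow>\<^sub>M count_space UNIV" "y \<in> borel_measurable N"
  shows "(\<lambda>x. (h x)(t := (a x, y x))) \<in> N \<rightarrow>\<^sub>M HM"
  by (rule measurable_fun_upd[where J = UNIV]) auto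

definition obs :: "nat \<Rightarrow> ('v \<Rightarrow> real) \<times> (nat \<Rightarrow> 'v \<times> real) \<Rightarrow> ('v \<Rightarrow> real) \<Rightarrow>
    (('v \<Rightarrow> real) \<times> (nat \<Rightarrow> 'v \<times> real)) measure" where
  "obs t x Th = distr (density lborel (normal_density (fst x (act Th)) s)) SM
      (\<lambda>y. (fst x, (snd x)(t := (act Th, y))))"

lemma obs_kernel: "(\<lambda>(x, Th). obs t x Th) \<in> SM \<Otimes>\<^sub>M PM \<rightarrow>\<^sub>M prob_algebra SM"
proof -
  have 1: "(\<lambda>z. density lborel (normal_density (fst (fst z) (act (snd z))) s))
     \<in> SM \<Otimes>\<^sub>M PM \<rightarrow>\<^sub>M prob_algebra lborel"
  proof (rule density_kernel)
    show "sigma_finite_measure (lborel :: real measure)" ..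
    show "(\<lambda>(x, y). ennreal (normal_density (fst (fst x) (act (snd x))) s y))
      \<in> borel_measurable ((SM \<Otimes>\<^sub>M PM) \<Otimes>\<^sub>M lborel)"
      unfolding split_beta' SM_eq
      by (intro measurable_compose[OF _ measurable_ennreal] normal_density_measurable
          param_measurable[where f = "\<lambda>x. fst (fst (fst x))"]) measurable
  qed (use s_pos in simp)
  have 2: "(\<lambda>(z, y). (fst (fst z), (snd (fst z))(t := (act (snd z), y))))
      \<in> (SM \<Otimes>\<^sub>M PM) \<Otimes>\<^sub>M lborel \<rightarrow>\<^sub>M SM"
    unfolding split_beta' SM_eq by (intro measurable_Pair upd_measurable) measurable
  show ?thesis
    using measurable_distr_prob_space2[OF 1 2] by (simp add: obs_def[abs_def] split_beta')
qed

lemma step_kernel: "(\<lambda>x. post t (snd x) \<bind> obs t x) \<in> SM \<rightarrow>\<^sub>M prob_algebra SM"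
  by (rule measurable_bind_prob_space2[OF _ obs_kernel]) (simp add: SM_eq)

lemma law_Suc: "law (Suc t) = law t \<bind> (\<lambda>x. post t (snd x) \<bind> obs t x)"
  by (simp add: obs_def[abs_def] split_beta' Let_def)

declare hts_law.simps(2) [simp del]

lemma law_space: "law t \<in> space (prob_algebra SM)"
proof (induction t)
  case 0
  have "(\<lambda>th. (th, \<lambda>_. undefined)) \<in> PM \<rightarrow>\<^sub>M SM" unfolding SM_eq by measurable
  thus ?case using prob_P
    by (auto simp: space_prob_algebra intro!: prob_space.prob_space_distr)
next
  case (Suc t)
  \<comment> \<open>A single law is viewed as a constant kernel on a one-point space, so that
    composition of kernels applies to it.\<close>
  have "(\<lambda>_. law (Suc t)) \<in> count_space (UNIV :: unit set) \<rightarrow>\<^sub>M prob_algebra SM"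
    unfolding law_Suc
    by (rule measurable_bind_prob_space[OF _ step_kernel]) (use Suc in simp)
  thus ?case by (auto dest: measurable_space)
qed

lemma prob_law: "prob_space (law t)" and sets_law [simp, measurable_cong]: "sets (law t) = sets SM"
  using law_space[of t] by (auto simp: space_prob_algebra)

lemma nn_integral_obs:
  assumes [measurable]: "F \<in> borel_measurable SM" and x: "x \<in> space SM" and Th: "Th \<in> space PM"
  shows "(\<integral>\<^sup>+z. F z \<partial>obs t x Th) = (\<integral>\<^sup>+y. ennreal (normal_density (fst x (act Th)) s y) *
      F (fst x, (snd x)(t := (act Th, y))) \<partial>lborel)"
proof -
  have x': "fst x \<in> space PM" using x by (auto simp: SM_eq space_pair_measure)
  have [measurable]: "(\<lambda>y. (fst x, (snd x)(t := (act Th, y)))) \<in> borel \<rightarrow>\<^sub>M SM"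
    unfolding SM_eq by (intro measurable_Pair upd_measurable) (use x' in auto)
  show ?thesis unfolding obs_def
    by (subst nn_integral_distr) (auto simp: nn_integral_density)
qed

lemma nn_integral_law_Suc:
  assumes F [measurable]: "F \<in> borel_measurable SM"
  shows "(\<integral>\<^sup>+x. F x \<partial>law (Suc t)) =
    (\<integral>\<^sup>+x. \<integral>\<^sup>+Th. \<integral>\<^sup>+y. ennreal (normal_density (fst x (act Th)) s y) *
      F (fst x, (snd x)(t := (act Th, y))) \<partial>lborel \<partial>post t (snd x) \<partial>law t)"
proof -
  have "(\<integral>\<^sup>+x. F x \<partial>law (Suc t)) = (\<integral>\<^sup>+x. \<integral>\<^sup>+z. F z \<partial>(post t (snd x) \<bind> obs t x) \<partial>law t)"
    unfolding law_Suc
    using measurable_prob_algebraD[OF step_kernel]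
    by (intro nn_integral_bind[where B = SM] F) (simp cong: measurable_cong_sets)
  also have "\<dots> = (\<integral>\<^sup>+x. \<integral>\<^sup>+Th. \<integral>\<^sup>+z. F z \<partial>obs t x Th \<partial>post t (snd x) \<partial>law t)"
  proof (intro nn_integral_cong nn_integral_bind[where B = SM] F)
    fix x assume "x \<in> space (law t)"
    hence "x \<in> space SM" by (simp add: sets_eq_imp_space_eq[OF sets_law])
    from measurable_compose[OF measurable_Pair1'[OF this] measurable_prob_algebraD[OF obs_kernel]]
    show "obs t x \<in> post t (snd x) \<rightarrow>\<^sub>M subprob_algebra SM" by (simp cong: measurable_cong_sets)
  qed
  also have "\<dots> = (\<integral>\<^sup>+x. \<integral>\<^sup>+Th. \<integral>\<^sup>+y. ennreal (normal_density (fst x (act Th)) s y) *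
      F (fst x, (snd x)(t := (act Th, y))) \<partial>lborel \<partial>post t (snd x) \<partial>law t)"
    by (intro nn_integral_cong nn_integral_obs F) (auto simp: sets_eq_imp_space_eq[OF sets_law])
  finally show ?thesis .
qed

end

section \<open>Bayes' rule for the history\<close>

context gauss_tree
begin

lemma space_law [simp]: "space (law t) = space SM"
  by (rule sets_eq_imp_space_eq) simp

text \<open>
  Integration against the unnormalised law of the history in which the observations are Lebesgue
  distributed; weighting it by prior and likelihood gives the joint law of parameter and history.
\<close>

primrec hist_int :: "nat \<Rightarrow> ((nat \<Rightarrow> 'v \<times> real) \<Rightarrow> ennreal) \<Rightarrow> ennreal" where
  "hist_int 0 F = F (\<lambda>_. undefined)"
| "hist_int (Suc t) F = hist_int t (\<lambda>h. \<integral>\<^sup>+Th. \<integral>\<^sup>+y. F (h(t := (act Th, y))) \<partial>lborel \<partial>post t h)"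

lemma obs_density_measurable:
  assumes [measurable]: "f \<in> N \<rightarrow>\<^sub>M PM" "g \<in> N \<rightarrow>\<^sub>M HM" "k \<in> N \<rightarrow>\<^sub>M PM" "y \<in> borel_measurable N"
    and [measurable]: "F \<in> borel_measurable SM"
  shows "(\<lambda>x. ennreal (normal_density (f x (act (k x))) s (y x)) *
      F (f x, (g x)(t := (act (k x), y x)))) \<in> borel_measurable N"
proof -
  have [measurable]: "(\<lambda>x. (f x, (g x)(t := (act (k x), y x)))) \<in> N \<rightarrow>\<^sub>M SM"
    unfolding SM_eq by (intro measurable_Pair upd_measurable) measurable
  have [measurable]: "(\<lambda>x. normal_density (f x (act (k x))) s (y x)) \<in> borel_measurable N"
    by (intro normal_density_measurable param_measurable[where f = f]) measurable
  show ?thesis by measurable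
qed

text \<open>The posterior, and with it the choice of the action, depends on the history alone. The
  true parameters enter a round only through the density of the reward; these densities multiply up
  to the likelihood, and Tonelli's theorem moves the integral over the prior inside those over
  sample and reward.\<close>

lemma law_hist_int:
  assumes "F \<in> borel_measurable SM"
  shows "(\<integral>\<^sup>+x. F x \<partial>law t) = hist_int t (\<lambda>h. \<integral>\<^sup>+th. ennreal (lik s t h th) * F (th, h) \<partial>P)"
  using assms
proof (induction t arbitrary: F)
  case (0 F)
  have [measurable]: "(\<lambda>th. (th, \<lambda>_. undefined)) \<in> PM \<rightarrow>\<^sub>M SM" unfolding SM_eq by measurable
  show ?case using 0 by (simp add: nn_integral_distr lik_def)
next
  case (Suc t F)
  note F [measurable] = Suc.prems
  define F' where "F' x = (\<integral>\<^sup>+Th. \<integral>\<^sup>+y. ennreal (normal_density (fst x (act Th)) s y) *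
      F (fst x, (snd x)(t := (act Th, y))) \<partial>lborel \<partial>post t (snd x))" for x
  have "(\<lambda>(x, Th). \<integral>\<^sup>+y. ennreal (normal_density (fst x (act Th)) s y) *
      F (fst x, (snd x)(t := (act Th, y))) \<partial>lborel) \<in> borel_measurable (SM \<Otimes>\<^sub>M PM)"
    unfolding split_beta' 
    by (rule lborel.borel_measurable_nn_integral, unfold split_beta', rule obs_density_measurable)
       (use F in \<open>auto simp: SM_eq\<close>)
  hence F': "F' \<in> borel_measurable SM"
    unfolding F'_def
    by (rule nn_integral_measurable_subprob_algebra2)
       (auto simp: SM_eq intro: measurable_compose[OF measurable_snd measurable_prob_algebraD[OF post_kernel]])
  have "(\<integral>\<^sup>+th. ennreal (lik s t h th) * F' (th, h) \<partial>P) = (\<integral>\<^sup>+Th. \<integral>\<^sup>+y.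
      (\<integral>\<^sup>+th. ennreal (lik s (Suc t) (h(t := (act Th, y))) th) * F (th, h(t := (act Th, y))) \<partial>P) \<partial>lborel \<partial>post t h)"
    for h
  proof -
    let ?q = "\<lambda>th Th y. ennreal (normal_density (th (act Th)) s y) * F (th, h(t := (act Th, y)))"
    let ?g = "\<lambda>th Th y. ennreal (lik s t h th) * ?q th Th y"
    interpret prP: prob_space P by (rule prob_P)
    interpret prQ: prob_space "post t h" by (rule prob_post)
    interpret PQ: pair_sigma_finite P "post t h" by unfold_locales
    interpret PL: pair_sigma_finite P "lborel :: real measure" by unfold_locales
    have [measurable]: "lik s t h \<in> borel_measurable PM" by (rule lik_measurable1)
    \<comment> \<open>Stated for arbitrary measurable arguments, because each exchange of integrals
      asks for measurability on a different product space.\<close>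
    have q [measurable]: "(\<lambda>x. ?q (f x) (k x) (y x)) \<in> borel_measurable N"
      if "f \<in> N \<rightarrow>\<^sub>M PM" "k \<in> N \<rightarrow>\<^sub>M PM" "y \<in> borel_measurable N" for f k y N
      by (rule obs_density_measurable[OF that(1) _ that(2,3)]) auto
    have g: "(\<lambda>x. ?g (f x) (k x) (y x)) \<in> borel_measurable N"
      if [measurable]: "f \<in> N \<rightarrow>\<^sub>M PM" "k \<in> N \<rightarrow>\<^sub>M PM" "y \<in> borel_measurable N" for f k y N
      by measurable
    have "(\<integral>\<^sup>+th. ennreal (lik s t h th) * F' (th, h) \<partial>P) = (\<integral>\<^sup>+th. \<integral>\<^sup>+Th. \<integral>\<^sup>+y. ?g th Th y \<partial>lborel \<partial>post t h \<partial>P)"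
    proof (intro nn_integral_cong)
      fix th assume "th \<in> space P"
      hence th: "th \<in> space PM" by simp
      have 1: "(\<lambda>Th. \<integral>\<^sup>+y. ?q th Th y \<partial>lborel) \<in> borel_measurable (post t h)"
        by (rule lborel.borel_measurable_nn_integral, unfold split_beta', rule q) (use th in auto)
      have 2: "(\<lambda>y. ?q th Th y) \<in> borel_measurable lborel" if "Th \<in> space (post t h)" for Th
        by (rule q) (use th that in auto)
      show "ennreal (lik s t h th) * F' (th, h) = (\<integral>\<^sup>+Th. \<integral>\<^sup>+y. ?g th Th y \<partial>lborel \<partial>post t h)"
        unfolding F'_def fst_conv snd_conv nn_integral_cmult[OF 1, symmetric]
        by (intro nn_integral_cong nn_integral_cmult[symmetric] 2)
    qed
    also have "\<dots> = (\<integral>\<^sup>+Th. \<integral>\<^sup>+th. \<integral>\<^sup>+y. ?g th Th y \<partial>lborel \<partial>P \<partial>post t h)"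
    proof (rule PQ.Fubini'[symmetric])
      show "(\<lambda>(th, Th). \<integral>\<^sup>+y. ?g th Th y \<partial>lborel) \<in> borel_measurable (P \<Otimes>\<^sub>M post t h)"
        unfolding split_beta'
        by (rule lborel.borel_measurable_nn_integral, unfold split_beta', rule g) measurable
    qed
    also have "\<dots> = (\<integral>\<^sup>+Th. \<integral>\<^sup>+y. \<integral>\<^sup>+th. ?g th Th y \<partial>P \<partial>lborel \<partial>post t h)"
    proof (intro nn_integral_cong PL.Fubini'[symmetric])
      fix Th assume "Th \<in> space (post t h)"
      thus "(\<lambda>(th, y). ?g th Th y) \<in> borel_measurable (P \<Otimes>\<^sub>M lborel)"
        unfolding split_beta' by (intro g) auto
    qed
    finally show ?thesis
      by (simp add: lik_upd ennreal_mult'' mult.assoc)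
  qed
  thus ?case
    using Suc.IH[OF F'] nn_integral_law_Suc[OF F, of t] by (simp add: F'_def)
qed

text \<open>For a fixed history, prior times likelihood equals evidence times posterior, so the true
  parameters may be replaced by a fresh posterior draw.\<close>

lemma bayes_identity:
  assumes F [measurable]: "F \<in> borel_measurable SM"
  shows "(\<integral>\<^sup>+x. F x \<partial>law t) = (\<integral>\<^sup>+x. \<integral>\<^sup>+Th. F (Th, snd x) \<partial>post t (snd x) \<partial>law t)"
proof -
  let ?F' = "\<lambda>x. \<integral>\<^sup>+Th. F (Th, snd x) \<partial>post t (snd x)"
  have "(\<lambda>(x, Th). F (Th, snd x)) \<in> borel_measurable (SM \<Otimes>\<^sub>M PM)"
    using F unfolding SM_eq by measurable
  hence F': "?F' \<in> borel_measurable SM"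
    by (rule nn_integral_measurable_subprob_algebra2)
       (auto simp: SM_eq intro: measurable_compose[OF measurable_snd measurable_prob_algebraD[OF post_kernel]])
  have "(\<integral>\<^sup>+th. ennreal (lik s t h th) * F (th, h) \<partial>P)
      = (\<integral>\<^sup>+th. ennreal (lik s t h th) * ?F' (th, h) \<partial>P)" for h
  proof -
    have [measurable]: "(\<lambda>th. F (th, h)) \<in> borel_measurable PM"
      using F unfolding SM_eq by measurable
    have [measurable]: "lik s t h \<in> borel_measurable PM" by (rule lik_measurable1)
    have "(\<integral>\<^sup>+th. ennreal (lik s t h th) * ?F' (th, h) \<partial>P)
       = evid t h * (\<integral>\<^sup>+Th. F (Th, h) \<partial>post t h)"
      unfolding evid_def by (simp add: nn_integral_multc)
    also have "\<dots> = (\<integral>\<^sup>+th. ennreal (lik s t h th) * F (th, h) \<partial>P)"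
      using evid_pos[of t h] evid_fin[of t h]
      by (simp add: nn_integral_post ennreal_times_divide ennreal_mult_divide_eq mult.commute[of "evid t h"])
    finally show ?thesis by simp
  qed
  thus ?thesis by (simp add: law_hist_int[OF F] law_hist_int[OF F'])
qed

text \<open>Later rounds are probability kernels that change only later entries of the history, so
  they integrate out to 1.\<close>

lemma law_marginal:
  assumes F: "F \<in> borel_measurable SM"
    and past: "\<And>k th h z. m \<le> k \<Longrightarrow> F (th, h(k := z)) = F (th, h)" and "m \<le> n"
  shows "(\<integral>\<^sup>+x. F x \<partial>law n) = (\<integral>\<^sup>+x. F x \<partial>law m)"
  using \<open>m \<le> n\<close>
proof (induction n rule: dec_induct)
  case (step n)
  have "(\<integral>\<^sup>+Th. \<integral>\<^sup>+y. ennreal (normal_density (fst x (act Th)) s y) *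
      F (fst x, (snd x)(n := (act Th, y))) \<partial>lborel \<partial>post n (snd x)) = F x" for x
  proof -
    interpret prob_space "post n (snd x)" by (rule prob_post)
    have "(\<integral>\<^sup>+Th. \<integral>\<^sup>+y. ennreal (normal_density (fst x (act Th)) s y) *
      F (fst x, (snd x)(n := (act Th, y))) \<partial>lborel \<partial>post n (snd x)) = (\<integral>\<^sup>+Th. F x \<partial>post n (snd x))"
      using step(1) s_pos by (simp add: past nn_integral_multc)
    also have "\<dots> = F x" using emeasure_space_1 by simp
    finally show ?thesis .
  qed
  thus ?case using step.IH by (simp add: nn_integral_law_Suc[OF F])
qed simp

text \<open>On the right of the second claim \<open>th\<close> and \<open>Th\<close> are independent
  draws from one posterior: \<open>th\<close> stands for the true parameters by
  \<open>bayes_identity\<close>, \<open>Th\<close> for the sample that selects the action.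
  \<open>\<Psi>\<close> sees only entries before \<open>t\<close>; the action of the round is passed
  as an argument.\<close>

lemma round_expectation:
  fixes \<Psi> :: "('v \<Rightarrow> real) \<Rightarrow> (nat \<Rightarrow> 'v \<times> real) \<Rightarrow> 'v \<Rightarrow> ennreal"
  assumes meas: "\<And>a. a \<in> L \<Longrightarrow> (\<lambda>x. \<Psi> (fst x) (snd x) a) \<in> borel_measurable SM"
    and zero: "\<And>th h a. a \<notin> L \<Longrightarrow> \<Psi> th h a = 0"
    and past: "\<And>k th h z a. t \<le> k \<Longrightarrow> \<Psi> th (h(k := z)) a = \<Psi> th h a" and "t < n"
  shows "(\<lambda>x. \<Psi> (fst x) (snd x) (fst (snd x t))) \<in> borel_measurable SM"
    and "(\<integral>\<^sup>+x. \<Psi> (fst x) (snd x) (fst (snd x t)) \<partial>law n) =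
      (\<integral>\<^sup>+x. \<integral>\<^sup>+th. \<integral>\<^sup>+Th. \<Psi> th (snd x) (act Th) \<partial>post t (snd x) \<partial>post t (snd x) \<partial>law t)"
    and "(\<lambda>x. \<integral>\<^sup>+Th. \<Psi> (fst x) (snd x) (act Th) \<partial>post t (snd x)) \<in> borel_measurable SM"
proof -
  \<comment> \<open>Measurability is given for each fixed leaf only; as \<open>\<Psi>\<close>
    vanishes off the leaves, a random action is handled by a finite sum.\<close>
  have sum: "\<Psi> th h a = (\<Sum>b\<in>L. if a = b then \<Psi> th h b else 0)" for th h a
    using zero[of a th h] by (cases "a \<in> L") (auto simp: sum.delta')
  have sm: "(\<lambda>x. \<Psi> (fst (f x)) (snd (f x)) (g x)) \<in> borel_measurable N"
    if f [measurable]: "f \<in> N \<rightarrow>\<^sub>M SM" and g [measurable]: "g \<in> N \<rightarrow>\<^sub>M count_space UNIV" for f g N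
  proof -
    have [measurable]: "(\<lambda>x. \<Psi> (fst (f x)) (snd (f x)) b) \<in> borel_measurable N" if "b \<in> L" for b
      using measurable_compose[OF f meas[OF that]] .
    show ?thesis by (subst sum) measurable
  qed
  define F where "F x = \<Psi> (fst x) (snd x) (fst (snd x t))" for x
  have "(\<lambda>x. fst (snd x t)) \<in> SM \<rightarrow>\<^sub>M count_space UNIV"
    unfolding SM_eq by measurable
  from sm[OF measurable_ident_sets[OF refl] this] have F: "F \<in> borel_measurable SM"
    unfolding F_def by simp
  thus "(\<lambda>x. \<Psi> (fst x) (snd x) (fst (snd x t))) \<in> borel_measurable SM" unfolding F_def .
  define F2 where "F2 x = (\<integral>\<^sup>+Th. \<Psi> (fst x) (snd x) (act Th) \<partial>post t (snd x))" for x
  have "(\<lambda>(x, Th). \<Psi> (fst x) (snd x) (act Th)) \<in> borel_measurable (SM \<Otimes>\<^sub>M PM)"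
    unfolding split_beta' by (rule sm) measurable
  hence F2: "F2 \<in> borel_measurable SM"
    unfolding F2_def by (rule nn_integral_measurable_subprob_algebra2)
       (auto simp: SM_eq intro: measurable_compose[OF measurable_snd measurable_prob_algebraD[OF post_kernel]])
  thus "(\<lambda>x. \<integral>\<^sup>+Th. \<Psi> (fst x) (snd x) (act Th) \<partial>post t (snd x)) \<in> borel_measurable SM"
    unfolding F2_def .
  have "(\<integral>\<^sup>+x. F x \<partial>law n) = (\<integral>\<^sup>+x. F x \<partial>law (Suc t))"
    using \<open>t < n\<close> by (intro law_marginal F) (auto simp: F_def past)
  also have "\<dots> = (\<integral>\<^sup>+x. F2 x \<partial>law t)"
    unfolding nn_integral_law_Suc[OF F] F2_def using s_pos
    by (simp add: F_def past nn_integral_multc)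
  also have "\<dots> = (\<integral>\<^sup>+x. \<integral>\<^sup>+th. F2 (th, snd x) \<partial>post t (snd x) \<partial>law t)"
    by (rule bayes_identity[OF F2])
  finally show "(\<integral>\<^sup>+x. \<Psi> (fst x) (snd x) (fst (snd x t)) \<partial>law n) =
      (\<integral>\<^sup>+x. \<integral>\<^sup>+th. \<integral>\<^sup>+Th. \<Psi> th (snd x) (act Th) \<partial>post t (snd x) \<partial>post t (snd x) \<partial>law t)"
    by (simp add: F_def F2_def)
qed

text \<open>The history space admits arbitrary actions, while the posterior formulas are established
  for histories of leaf pulls. The one-round formula for the indicator of the leaves gives
  probability one, since the sampled maximiser is always a leaf.\<close>

lemma AE_actions: "AE x in law n. \<forall>t<n. fst (snd x t) \<in> L"
proof -
  have "AE x in law n. fst (snd x t) \<in> L" if t: "t < n" for t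
  proof -
    interpret prob_space "law n" by (rule prob_law)
    let ?\<Psi> = "\<lambda>(th :: 'v \<Rightarrow> real) (h :: nat \<Rightarrow> 'v \<times> real) a. indicator L a :: ennreal"
    have m: "(\<lambda>x. indicator L (fst (snd x t)) :: ennreal) \<in> borel_measurable SM"
      by (rule round_expectation(1)[where \<Psi> = ?\<Psi> and n = n]) (use t in auto)
    have A [measurable]: "{x \<in> space SM. fst (snd x t) \<in> L} \<in> sets SM"
    proof -
      have "{x \<in> space SM. fst (snd x t) \<in> L} = (\<lambda>x. indicator L (fst (snd x t)) :: ennreal) -` {1} \<inter> space SM"
        by (auto simp: indicator_def split: if_splits)
      thus ?thesis using m by (simp add: measurable_sets)
    qed
    have "emeasure (law n) {x \<in> space SM. fst (snd x t) \<in> L}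
        = (\<integral>\<^sup>+x. indicator {x \<in> space SM. fst (snd x t) \<in> L} x \<partial>law n)"
      by (rule nn_integral_indicator[symmetric]) simp
    also have "\<dots> = (\<integral>\<^sup>+x. indicator L (fst (snd x t)) \<partial>law n)"
      by (intro nn_integral_cong) (simp add: indicator_def)
    also have "\<dots> = (\<integral>\<^sup>+x. \<integral>\<^sup>+th. \<integral>\<^sup>+Th. indicator L (act Th) \<partial>post t (snd x) \<partial>post t (snd x) \<partial>law t)"
      by (rule round_expectation(2)[where \<Psi> = ?\<Psi>]) (use t in auto)
    also have "\<dots> = 1"
      using prob_space.emeasure_space_1[OF prob_post] prob_space.emeasure_space_1[OF prob_law]
      by simp
    finally have "prob {x \<in> space SM. fst (snd x t) \<in> L} = 1"
      by (simp add: measure_def)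
    from AE_prob_1[OF this] show ?thesis by (rule AE_mp) auto
  qed
  thus ?thesis by (subst AE_all_countable) (auto simp: AE_all_countable)
qed

end

section \<open>Posterior marginals and the regret of one round\<close>

text \<open>Where the excess is positive it is at most \<open>x - m\<close>, and
  \<open>x - m\<close> times the density has the antiderivative \<open>- \<sigma>\<^sup>2\<close>
  times the density. Only the boundary value at \<open>m + c * \<sigma>\<close> survives.\<close>

lemma normal_excess:
  fixes m \<sigma> c :: real
  assumes \<sigma>: "\<sigma> > 0" and c: "c \<ge> 0"
  shows "(\<integral>\<^sup>+x. ennreal (max 0 (x - m - c * \<sigma>)) * ennreal (normal_density m \<sigma> x) \<partial>lborel)
    \<le> ennreal (\<sigma> * exp (- c\<^sup>2 / 2) / sqrt (2 * pi))"
proof -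
  let ?a = "m + c * \<sigma>"
  let ?F = "\<lambda>x. - (\<sigma>\<^sup>2 * normal_density m \<sigma> x)"
  have "(\<integral>\<^sup>+x. ennreal (max 0 (x - m - c * \<sigma>)) * ennreal (normal_density m \<sigma> x) \<partial>lborel)
    \<le> (\<integral>\<^sup>+x. ennreal ((x - m) * normal_density m \<sigma> x) * indicator {?a..} x \<partial>lborel)"
  proof (rule nn_integral_mono)
    fix x
    have "max 0 (x - m - c * \<sigma>) * normal_density m \<sigma> x \<le> (x - m) * normal_density m \<sigma> x" if "?a \<le> x"
      using that \<sigma> c by (intro mult_right_mono) auto
    thus "ennreal (max 0 (x - m - c * \<sigma>)) * ennreal (normal_density m \<sigma> x)
        \<le> ennreal ((x - m) * normal_density m \<sigma> x) * indicator {?a..} x"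
      by (cases "?a \<le> x") (auto simp: ennreal_mult'[symmetric] max_def intro!: ennreal_leI)
  qed
  also have "\<dots> = ennreal (0 - ?F ?a)"
  proof (rule nn_integral_FTC_atLeast)
    show "((\<lambda>x. - (\<sigma>\<^sup>2 * normal_density m \<sigma> x)) has_real_derivative (x - m) * normal_density m \<sigma> x) (at x)" for x
    proof -
      define K where "K = 1 / sqrt (2 * pi * \<sigma>\<^sup>2)"
      show ?thesis
        unfolding normal_density_def K_def[symmetric] using \<sigma>
        by (auto intro!: derivative_eq_intros simp: field_simps power2_eq_square)
    qed
    show "0 \<le> (x - m) * normal_density m \<sigma> x" if "?a \<le> x" for x
    proof -
      have "0 \<le> c * \<sigma>" using \<sigma> c by simp
      thus ?thesis using that by simp
    qed
    have "filterlim (\<lambda>x. - (x - m)\<^sup>2 / (2 * \<sigma>\<^sup>2)) at_bot at_top"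
    proof -
      have "filterlim (\<lambda>x. - m + x) at_top at_top"
        by (rule filterlim_tendsto_add_at_top[OF tendsto_const filterlim_ident])
      hence "filterlim (\<lambda>x. x - m) at_top at_top" by simp
      hence "filterlim (\<lambda>x. (x - m)\<^sup>2) at_top at_top"
        by (intro filterlim_pow_at_top) simp_all
      hence "filterlim (\<lambda>x. (1 / (2 * \<sigma>\<^sup>2)) * (x - m)\<^sup>2) at_top at_top"
        using \<sigma> by (intro filterlim_tendsto_pos_mult_at_top[OF tendsto_const]) auto
      thus ?thesis by (simp add: filterlim_uminus_at_bot)
    qed
    hence "((\<lambda>x. exp (- (x - m)\<^sup>2 / (2 * \<sigma>\<^sup>2))) \<longlongrightarrow> 0) at_top"
      by (rule filterlim_compose[OF exp_at_bot])
    hence "((\<lambda>x. - (\<sigma>\<^sup>2 * (1 / sqrt (2 * pi * \<sigma>\<^sup>2) * exp (- (x - m)\<^sup>2 / (2 * \<sigma>\<^sup>2)))))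
        \<longlongrightarrow> - (\<sigma>\<^sup>2 * (1 / sqrt (2 * pi * \<sigma>\<^sup>2) * 0))) at_top"
      by (intro tendsto_intros)
    thus "((\<lambda>x. - (\<sigma>\<^sup>2 * normal_density m \<sigma> x)) \<longlongrightarrow> 0) at_top"
      unfolding normal_density_def by simp
  qed auto
  also have "0 - ?F ?a = \<sigma> * exp (- c\<^sup>2 / 2) / sqrt (2 * pi)"
    using \<sigma> by (simp add: normal_density_def power_mult_distrib real_sqrt_mult field_simps power2_eq_square)
  finally show ?thesis .
qed

text \<open>Separates the terms that are linear and quadratic in the mean from those of the
  observation alone, so that multiplying likelihoods amounts to adding coefficients.\<close>

lemma normal_density_as_exp:
  "s > 0 \<Longrightarrow> normal_density x s y =
    (1 / sqrt (2 * pi * s\<^sup>2) * exp (- y\<^sup>2 / (2 * s\<^sup>2))) * exp (y / s\<^sup>2 * x - 1 / s\<^sup>2 * x\<^sup>2 / 2)"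
proof -
  assume s: "s > 0"
  have "- (y - x)\<^sup>2 / (2 * s\<^sup>2) = - y\<^sup>2 / (2 * s\<^sup>2) + (y / s\<^sup>2 * x - 1 / s\<^sup>2 * x\<^sup>2 / 2)"
    using s by (simp add: field_simps power2_eq_square)
  thus ?thesis by (simp only: normal_density_def exp_add mult.assoc)
qed

context gauss_tree
begin

lemma hat_cong:
  assumes "\<And>l. l < k \<Longrightarrow> acts l = acts' l" shows "hat acts k = hat acts' k"
proof -
  have cnt: "cnt acts k = cnt acts' k"
    unfolding cnt_def using assms by (intro ext arg_cong[where f = card]) auto
  have "tprec V r pa s0 s acts k f j = tprec V r pa s0 s acts' k f j" for f j
    by (induction f arbitrary: j) (simp_all add: cnt)
  thus ?thesis by (intro ext) (simp add: hat_prec_def cnt)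
qed

lemma cnt_eq_sum: "real (cnt acts k i) = (\<Sum>l<k. if acts l = i then 1 else 0)"
  by (induction k) (auto simp: cnt_Suc)

abbreviation acts_of :: "(nat \<Rightarrow> 'v \<times> real) \<Rightarrow> nat \<Rightarrow> 'v" where
  "acts_of h \<equiv> (\<lambda>l. fst (h l))"

text \<open>Grouping observations by action turns the likelihood into a log-quadratic weight with
  quadratic coefficients \<open>obsprec\<close>, and elimination over all of \<open>V\<close>
  applies. The resulting constant is the same for every node and test function; the test function 1
  shows that it is the evidence, so it cancels.\<close>

lemma posterior_marginal:
  assumes good: "\<And>l. l < k \<Longrightarrow> fst (h l) \<in> L"
  shows "\<exists>m. \<forall>i\<in>V. \<forall>f\<in>borel_measurable borel. (\<integral>\<^sup>+th. f (th i) \<partial>post k h) =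
     (\<integral>\<^sup>+x. f x * ennreal (normal_density (m i) (sqrt (pvar (hat (acts_of h) k) i)) x) \<partial>lborel)"
proof -
  let ?H = "hat (acts_of h) k"
  define S where "S = obsprec (acts_of h) k"
  define b where "b i = (\<Sum>l<k. if fst (h l) = i then snd (h l) / s\<^sup>2 else 0)" for i
  define c0 where "c0 = (\<Prod>l<k. 1 / sqrt (2 * pi * s\<^sup>2) * exp (- (snd (h l))\<^sup>2 / (2 * s\<^sup>2)))"
  have c0: "0 < c0" unfolding c0_def using s_pos by (intro prod_pos) auto
  \<comment> \<open>At inner nodes \<open>obsprec\<close> is 0 by definition; this agrees with the
    likelihood because all past actions are leaves.\<close>
  have S: "S i = (\<Sum>l<k. if fst (h l) = i then 1 / s\<^sup>2 else 0)" for i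
  proof (cases "i \<in> L")
    case True
    thus ?thesis
      by (simp add: S_def obsprec_def cnt_eq_sum sum_divide_distrib if_distrib[of "\<lambda>x. x / _"] cong: if_cong)
  next
    case False
    hence "(\<Sum>l<k. if fst (h l) = i then 1 / s\<^sup>2 else 0) = 0"
      using good by (intro sum.neutral) auto
    thus ?thesis using False by (simp add: S_def obsprec_def)
  qed
  have lik: "lik s k h th = c0 * exp (\<Sum>i\<in>V. b i * th i - S i * (th i)\<^sup>2 / 2)" for th
  proof -
    let ?e = "\<lambda>l i. snd (h l) / s\<^sup>2 * th i - 1 / s\<^sup>2 * (th i)\<^sup>2 / 2"
    have "lik s k h th = c0 * (\<Prod>l<k. exp (?e l (fst (h l))))"
      unfolding lik_def c0_def by (simp only: normal_density_as_exp[OF s_pos] prod.distrib)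
    also have "(\<Prod>l<k. exp (?e l (fst (h l)))) = exp (\<Sum>l<k. ?e l (fst (h l)))"
      by (simp add: exp_sum)
    also have "(\<Sum>l<k. ?e l (fst (h l))) = (\<Sum>l<k. \<Sum>i\<in>V. if fst (h l) = i then ?e l i else 0)"
    proof (intro sum.cong refl)
      fix l assume "l \<in> {..<k}"
      hence "fst (h l) \<in> V" using good L_sub by blast
      thus "?e l (fst (h l)) = (\<Sum>i\<in>V. if fst (h l) = i then ?e l i else 0)"
        by (subst sum.delta') auto
    qed
    also have "\<dots> = (\<Sum>i\<in>V. \<Sum>l<k. if fst (h l) = i then ?e l i else 0)" by (rule sum.swap)
    also have "\<dots> = (\<Sum>i\<in>V. b i * th i - S i * (th i)\<^sup>2 / 2)"
      unfolding b_def S sum_distrib_right sum_divide_distrib sum_subtractf[symmetric]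
      by (intro sum.cong refl) auto
    finally show ?thesis .
  qed
  have S0: "0 \<le> S i" for i by (simp add: S_def)
  have Heq: "?H i = 1 / (s0 i)\<^sup>2 + S i +
        (\<Sum>j\<in>{j\<in>V - {r}. pa j = i}. 1 / (s0 j)\<^sup>2 - 1 / ((s0 j)^4 * ?H j))" for i
    unfolding hat_eq[of _ _ i] S_def ch_def by (intro arg_cong2[where f = "(+)"] sum.cong refl tp_eq) auto
  have "\<exists>K m. 0 < K \<and> (\<forall>i\<in>V. \<forall>f\<in>borel_measurable borel.
     (\<integral>\<^sup>+Z. ennreal (exp (\<Sum>i\<in>V. b i * node Z i - S i * (node Z i)\<^sup>2 / 2)) * f (node Z i) \<partial>PiM V incr)
     = ennreal K * (\<integral>\<^sup>+x. f x * ennreal (normal_density (m i) (sqrt (pvar ?H i)) x) \<partial>lborel))"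
    by (rule tilted_marginal_normal[OF anc_closed_V S0 hat_pos Heq])
  then obtain K m where K: "0 < K" and marg: "\<forall>i\<in>V. \<forall>f\<in>borel_measurable borel.
     (\<integral>\<^sup>+Z. ennreal (exp (\<Sum>i\<in>V. b i * node Z i - S i * (node Z i)\<^sup>2 / 2)) * f (node Z i) \<partial>PiM V incr)
     = ennreal K * (\<integral>\<^sup>+x. f x * ennreal (normal_density (m i) (sqrt (pvar ?H i)) x) \<partial>lborel)"
    by (elim exE conjE)
  have [measurable]: "lik s k h \<in> borel_measurable PM" by (rule lik_measurable1)
  have num: "(\<integral>\<^sup>+th. ennreal (lik s k h th) * f (th i) \<partial>P) = ennreal (c0 * K) *
      (\<integral>\<^sup>+x. f x * ennreal (normal_density (m i) (sqrt (pvar ?H i)) x) \<partial>lborel)"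
    if i: "i \<in> V" and f [measurable]: "f \<in> borel_measurable borel" for i and f :: "real \<Rightarrow> ennreal"
  proof -
    have [measurable]: "(\<lambda>Z. node Z i) \<in> borel_measurable (PiM V incr)" if "i \<in> V" for i
      by (rule node_measurable[OF anc_closed_V that])
    have "(\<integral>\<^sup>+th. ennreal (lik s k h th) * f (th i) \<partial>P)
      = (\<integral>\<^sup>+Z. ennreal c0 * (ennreal (exp (\<Sum>i\<in>V. b i * node Z i - S i * (node Z i)\<^sup>2 / 2)) * f (node Z i)) \<partial>PiM V incr)"
      using i c0 by (subst nn_integral_P) (auto simp: lik ennreal_mult' mult.assoc intro!: nn_integral_cong)
    also have "\<dots> = ennreal c0 * (\<integral>\<^sup>+Z. ennreal (exp (\<Sum>i\<in>V. b i * node Z i - S i * (node Z i)\<^sup>2 / 2)) * f (node Z i) \<partial>PiM V incr)"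
      using i by (intro nn_integral_cmult) measurable
    also have "\<dots> = ennreal (c0 * K) *
      (\<integral>\<^sup>+x. f x * ennreal (normal_density (m i) (sqrt (pvar ?H i)) x) \<partial>lborel)"
      unfolding marg[rule_format, OF i f] using c0 K by (simp add: ennreal_mult mult.assoc)
    finally show ?thesis .
  qed
  have pv: "0 < sqrt (pvar ?H i)" if "i \<in> V" for i
    using pvar_pos[OF that, of ?H] hat_pos by simp
  have ev: "evid k h = ennreal (c0 * K)"
    using num[OF r_V, of "\<lambda>_. 1"] pv[OF r_V] by (simp add: evid_def)
  have "(\<integral>\<^sup>+th. f (th i) \<partial>post k h) =
     (\<integral>\<^sup>+x. f x * ennreal (normal_density (m i) (sqrt (pvar ?H i)) x) \<partial>lborel)"
    if i: "i \<in> V" and f [measurable]: "f \<in> borel_measurable borel" for i and f :: "real \<Rightarrow> ennreal"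
  proof -
    have "(\<lambda>th. f (th i)) \<in> borel_measurable PM" using i by measurable
    from nn_integral_post[OF this, of k h] show ?thesis
      unfolding num[OF i f] ev mult.commute[of "ennreal (c0 * K)"]
      using c0 K by (subst (asm) ennreal_mult_divide_eq) auto
  qed
  thus ?thesis by blast
qed

definition psd :: "nat \<Rightarrow> (nat \<Rightarrow> 'v \<times> real) \<Rightarrow> 'v \<Rightarrow> real" where
  "psd k h a = sqrt (pvar (hat (acts_of h) k) a)"

lemma psd_pos: "i \<in> V \<Longrightarrow> 0 < psd k h i"
  using pvar_pos[of i "hat (acts_of h) k"] hat_pos by (simp add: psd_def)

lemma psd_le: assumes "a \<in> L" shows "psd k h a \<le> sigma_max V r pa s0"
proof -
  have "psd k h a \<le> sqrt (\<Sum>j\<in>anc r pa a. (s0 j)\<^sup>2)"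
    unfolding psd_def using pvar_le[of a] assms L_sub by auto
  also have "\<dots> \<le> sigma_max V r pa s0"
    unfolding sigma_max_def using assms by (intro Max_ge) auto
  finally show ?thesis .
qed

lemma psd_past: "k \<le> l \<Longrightarrow> psd k (h(l := z)) a = psd k h a"
  unfolding psd_def by (subst hat_cong[of k _ "acts_of h"]) auto

lemma psd_measurable [measurable]: "(\<lambda>h. psd k h a) \<in> borel_measurable HM"
proof -
  have cnt: "(\<lambda>h. real (cnt (acts_of h) k a)) \<in> borel_measurable HM" for a
    unfolding cnt_eq_sum by measurable
  have tp [measurable]: "(\<lambda>h. tprec V r pa s0 s (acts_of h) k f j) \<in> borel_measurable HM" for f j
  proof (induction f arbitrary: j)
    have leaf: "(\<lambda>h. if cnt (acts_of h) k j = 0 then 0 else 1 / ((s0 j)\<^sup>2 + s\<^sup>2 / real (cnt (acts_of h) k j)))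
        \<in> borel_measurable HM" for j
    proof -
      note cnt[measurable]
      have "Measurable.pred HM (\<lambda>h. real (cnt (acts_of h) k j) = 0)" by measurable
      hence [measurable]: "Measurable.pred HM (\<lambda>h. cnt (acts_of h) k j = 0)" by simp
      show ?thesis by measurable
    qed
    {
      case 0 show ?case using leaf[of j] by (cases "j \<in> L") simp_all
    next
      case (Suc f)
      note Suc[measurable]
      show ?case using leaf[of j] by (cases "j \<in> L") (simp_all add: Let_def)
    }
  qed
  have hm [measurable]: "(\<lambda>h. hat (acts_of h) k i) \<in> borel_measurable HM" for i
    unfolding hat_prec_def using cnt by (cases "i \<in> L") simp_all
  have "(\<lambda>h. pvar_aux (hat (acts_of h) k) d i) \<in> borel_measurable HM" for d i
    by (induction d arbitrary: i) simp_all
  thus ?thesis unfolding psd_def pvar_def by simp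
qed

lemma max_eq_act: "Max (th ` L) = (th (act th) :: real)"
  by (rule Max_eqI) (auto intro: arg_max_on_in leaves_nonempty)

text \<open>Because \<open>th\<close> and \<open>Th\<close> have the same law, the sampled action
  may be replaced by the maximiser of \<open>th\<close> wherever only posterior means are concerned.
  What remains is how far the maximum of \<open>th\<close> exceeds the posterior mean of the
  maximising leaf.\<close>

lemma posterior_regret:
  assumes good: "\<And>l. l < k \<Longrightarrow> fst (h l) \<in> L" and c: "c \<ge> 0"
  shows "(\<integral>\<^sup>+th. \<integral>\<^sup>+Th. ennreal (Max (th ` L) - th (act Th)) \<partial>post k h \<partial>post k h)
    \<le> (\<integral>\<^sup>+Th. ennreal (c * psd k h (act Th)) \<partial>post k h) +
       ennreal (sigma_max V r pa s0 * real (card L) * (exp (- c\<^sup>2 / 2) / sqrt (2 * pi)))"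
proof -
  let ?Q = "post k h"
  interpret Q: prob_space ?Q by (rule prob_post)
  have [simp]: "Q.prob (space PM) = 1" using Q.prob_space by simp
  interpret QQ: pair_sigma_finite ?Q ?Q by unfold_locales
  obtain m where marg: "\<And>i f. i \<in> V \<Longrightarrow> f \<in> borel_measurable borel \<Longrightarrow> (\<integral>\<^sup>+th. f (th i) \<partial>?Q) =
     (\<integral>\<^sup>+x. f x * ennreal (normal_density (m i) (psd k h i) x) \<partial>lborel)"
    using posterior_marginal[OF good] unfolding psd_def by meson
  have comp [measurable]: "(\<lambda>th. th a) \<in> borel_measurable ?Q" if "a \<in> L" for a
  proof -
    have "a \<in> V" using that L_sub by blast
    thus ?thesis by measurable
  qed
  have dist: "distributed ?Q lborel (\<lambda>th. th a) (normal_density (m a) (psd k h a))" if a: "a \<in> L" for a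
    unfolding distributed_def
  proof (intro conjI measure_eqI)
    fix A assume "A \<in> sets (distr ?Q lborel (\<lambda>th. th a))"
    hence A [measurable]: "A \<in> sets borel" by simp
    have "emeasure (distr ?Q lborel (\<lambda>th. th a)) A = (\<integral>\<^sup>+th. indicator A (th a) \<partial>?Q)"
      using comp[OF a] by (subst nn_integral_indicator[symmetric], simp, subst nn_integral_distr) simp_all
    also have "\<dots> = emeasure (density lborel (normal_density (m a) (psd k h a))) A"
      using a L_sub by (subst marg) (auto simp: emeasure_density mult.commute)
    finally show "emeasure (distr ?Q lborel (\<lambda>th. th a)) A = emeasure (density lborel (normal_density (m a) (psd k h a))) A" .
  qed (use comp[OF a] in auto)
  have pos: "0 < psd k h a" if "a \<in> L" for a using psd_pos that L_sub by blast
  have int: "integrable ?Q (\<lambda>th. th a)" and mean: "Q.expectation (\<lambda>th. th a) = m a" if a: "a \<in> L" for a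
  proof -
    show "Q.expectation (\<lambda>th. th a) = m a"
      by (rule Q.normal_distributed_expectation[OF pos[OF a] dist[OF a]])
    show "integrable ?Q (\<lambda>th. th a)"
      using distributed_integrable[OF dist[OF a], of "\<lambda>x. x"] integrable_normal_moment_nz_1[OF pos[OF a], of "m a"]
      by simp
  qed
  let ?sd = "\<lambda>th. c * psd k h (act th)"
  let ?ex = "\<lambda>a th. max 0 (th a - m a - c * psd k h a)"
  have mM [measurable]: "(\<lambda>th. th (act th)) \<in> borel_measurable ?Q"
    by (rule param_measurable[where f = "\<lambda>th. th"]) measurable
  have intM: "integrable ?Q (\<lambda>th. th (act th))"
  proof (rule Bochner_Integration.integrable_bound)
    show "integrable ?Q (\<lambda>th. \<Sum>a\<in>L. \<bar>th a\<bar>)" using int by auto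
    show "AE th in ?Q. norm (th (act th)) \<le> norm (\<Sum>a\<in>L. \<bar>th a\<bar>)"
    proof (intro AE_I2)
      fix th :: "'v \<Rightarrow> real"
      have "\<bar>th (act th)\<bar> \<le> (\<Sum>a\<in>L. \<bar>th a\<bar>)"
        by (rule member_le_sum) auto
      thus "norm (th (act th)) \<le> norm (\<Sum>a\<in>L. \<bar>th a\<bar>)" by simp
    qed
  qed measurable
  have intf: "integrable ?Q (\<lambda>th. g (act th))" for g :: "'v \<Rightarrow> real"
  proof (rule Q.integrable_const_bound)
    show "AE th in ?Q. norm (g (act th)) \<le> Max ((\<lambda>a. \<bar>g a\<bar>) ` L)"
      by (intro AE_I2) (auto intro!: Max_ge)
    show "(\<lambda>th. g (act th)) \<in> borel_measurable ?Q"
      by (rule measurable_compose[of act _ "count_space UNIV"]) measurable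
  qed
  have ex: "(\<integral>\<^sup>+th. ennreal (?ex a th) \<partial>?Q) \<le> ennreal (psd k h a * exp (- c\<^sup>2 / 2) / sqrt (2 * pi))"
    if a: "a \<in> L" for a
    using normal_excess[OF pos[OF a] c, of "m a"] marg[of a "\<lambda>x. ennreal (max 0 (x - m a - c * psd k h a))"] a L_sub
    by auto
  \<comment> \<open>Integrating over \<open>th\<close> with the played leaf \<open>b\<close> fixed
    gives the posterior mean of the maximum minus that of \<open>b\<close>.\<close>
  define EM where "EM = (\<integral>th. th (act th) \<partial>?Q)"
  have EM: "0 \<le> EM - m b" and EMn: "(\<integral>\<^sup>+th. ennreal (Max (th ` L) - th b) \<partial>?Q) = ennreal (EM - m b)"
    if b: "b \<in> L" for b
  proof -
    have le: "0 \<le> th (act th) - th b" for th :: "'v \<Rightarrow> real"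
      using arg_max_on_in(2)[of L b th] b leaves_nonempty by simp
    have eq: "(\<integral>th. th (act th) - th b \<partial>?Q) = EM - m b"
      using intM int[OF b] mean[OF b] by (simp add: EM_def)
    show "0 \<le> EM - m b" unfolding eq[symmetric] using le by (intro Bochner_Integration.integral_nonneg) auto
    show "(\<integral>\<^sup>+th. ennreal (Max (th ` L) - th b) \<partial>?Q) = ennreal (EM - m b)"
      unfolding max_eq_act eq[symmetric] using intM int[OF b] le
      by (intro nn_integral_eq_integral) auto
  qed
  have "(\<integral>\<^sup>+th. \<integral>\<^sup>+Th. ennreal (Max (th ` L) - th (act Th)) \<partial>?Q \<partial>?Q)
     = (\<integral>\<^sup>+Th. \<integral>\<^sup>+th. ennreal (Max (th ` L) - th (act Th)) \<partial>?Q \<partial>?Q)"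
  proof (rule QQ.Fubini'[symmetric])
    have [measurable]: "(\<lambda>x. fst x (act (fst x))) \<in> borel_measurable (?Q \<Otimes>\<^sub>M ?Q)"
        "(\<lambda>x. fst x (act (snd x))) \<in> borel_measurable (?Q \<Otimes>\<^sub>M ?Q)"
      by (rule param_measurable[where f = fst]; measurable)+
    show "(\<lambda>(th, Th). ennreal (Max (th ` L) - th (act Th))) \<in> borel_measurable (?Q \<Otimes>\<^sub>M ?Q)"
      unfolding max_eq_act split_beta' by measurable
  qed
  also have "\<dots> = (\<integral>\<^sup>+Th. ennreal (EM - m (act Th)) \<partial>?Q)"
    by (intro nn_integral_cong EMn) simp
  also have "\<dots> = ennreal (\<integral>Th. EM - m (act Th) \<partial>?Q)"
    using EM intf by (intro nn_integral_eq_integral) auto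
  \<comment> \<open>Equality of laws enters here: after \<open>EM\<close> is unfolded, both terms
    are integrals over one and the same draw.\<close>
  also have "(\<integral>Th. EM - m (act Th) \<partial>?Q) = (\<integral>th. th (act th) - m (act th) \<partial>?Q)"
    using intf[of m] intM by (simp add: EM_def Q.prob_space)
  \<comment> \<open>The integrand may be negative; bounding it by its positive part leads back to
    nonnegative integrals.\<close>
  also have "ennreal \<dots> \<le> (\<integral>\<^sup>+th. ennreal (th (act th) - m (act th)) \<partial>?Q)"
  proof -
    have "ennreal (\<integral>th. th (act th) - m (act th) \<partial>?Q) \<le> ennreal (\<integral>th. max 0 (th (act th) - m (act th)) \<partial>?Q)"
      using intf[of m] intM by (intro ennreal_leI integral_mono) auto
    also have "\<dots> = (\<integral>\<^sup>+th. ennreal (max 0 (th (act th) - m (act th))) \<partial>?Q)"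
      using intf[of m] intM by (intro nn_integral_eq_integral[symmetric]) auto
    also have "\<dots> = (\<integral>\<^sup>+th. ennreal (th (act th) - m (act th)) \<partial>?Q)"
      by (intro nn_integral_cong) (auto simp: max_def ennreal_neg)
    finally show ?thesis .
  qed
  also have "\<dots> \<le> (\<integral>\<^sup>+th. ennreal (?sd th) + (\<Sum>a\<in>L. ennreal (?ex a th)) \<partial>?Q)"
  proof (intro nn_integral_mono)
    fix th :: "'v \<Rightarrow> real"
    have 1: "?ex (act th) th \<le> (\<Sum>a\<in>L. ?ex a th)"
      by (rule member_le_sum[of _ _ "\<lambda>a. ?ex a th"]) auto
    have "ennreal (th (act th) - m (act th)) \<le> ennreal (?sd th + (\<Sum>a\<in>L. ?ex a th))"
      using 1 by (intro ennreal_leI) (simp add: max_def split: if_splits)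
    also have "\<dots> = ennreal (?sd th) + (\<Sum>a\<in>L. ennreal (?ex a th))"
    proof -
      have "(\<Sum>a\<in>L. ennreal (?ex a th)) = ennreal (\<Sum>a\<in>L. ?ex a th)"
        by (rule sum_ennreal) simp
      moreover have "0 \<le> ?sd th" using c pos[of "act th"] by simp
      ultimately show ?thesis by (simp only: ennreal_plus sum_nonneg max.cobounded1)
    qed
    finally show "ennreal (th (act th) - m (act th)) \<le> ennreal (?sd th) + (\<Sum>a\<in>L. ennreal (?ex a th))" .
  qed
  also have "\<dots> = (\<integral>\<^sup>+th. ennreal (?sd th) \<partial>?Q) + (\<Sum>a\<in>L. \<integral>\<^sup>+th. ennreal (?ex a th) \<partial>?Q)"
    using intf[of "\<lambda>a. c * psd k h a"]
    by (subst nn_integral_add) (auto intro!: nn_integral_sum)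
  also have "\<dots> \<le> (\<integral>\<^sup>+th. ennreal (?sd th) \<partial>?Q) +
      (\<Sum>a\<in>L. ennreal (sigma_max V r pa s0 * (exp (- c\<^sup>2 / 2) / sqrt (2 * pi))))"
  proof (intro add_left_mono sum_mono)
    fix a assume a: "a \<in> L"
    have "psd k h a * exp (- c\<^sup>2 / 2) / sqrt (2 * pi) \<le> sigma_max V r pa s0 * (exp (- c\<^sup>2 / 2) / sqrt (2 * pi))"
      using mult_right_mono[OF psd_le[OF a], of "exp (- c\<^sup>2 / 2) / sqrt (2 * pi)"] by simp
    thus "(\<integral>\<^sup>+th. ennreal (?ex a th) \<partial>?Q) \<le> ennreal (sigma_max V r pa s0 * (exp (- c\<^sup>2 / 2) / sqrt (2 * pi)))"
      using ex[OF a] by (meson ennreal_leI order_trans)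
  qed
  also have "(\<Sum>a\<in>L. ennreal (sigma_max V r pa s0 * (exp (- c\<^sup>2 / 2) / sqrt (2 * pi))))
      = ennreal (sigma_max V r pa s0 * real (card L) * (exp (- c\<^sup>2 / 2) / sqrt (2 * pi)))"
    by (simp add: ennreal_of_nat_eq_real_of_nat ennreal_mult'[symmetric] mult_ac)
  finally show ?thesis .
qed

end

section \<open>The regret bound\<close>

context gauss_tree
begin

lemma sum_psd_le:
  assumes c0: "c > 0"
    and c: "\<And>acts k i. (\<forall>l. acts l \<in> L) \<Longrightarrow> k < n \<Longrightarrow> i \<in> V \<Longrightarrow> hat acts (Suc k) i \<le> c * hat acts k i"
    and good: "\<And>t. t < n \<Longrightarrow> fst (h t) \<in> L"
  shows "(\<Sum>t<n. psd t h (fst (h t))) \<le> sqrt (real n * G V r pa s0 s c n)"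
proof -
  obtain a0 where a0: "a0 \<in> L" using leaves_nonempty by blast
  \<comment> \<open>The growth condition concerns infinite sequences of leaves, while only the first
    \<open>n\<close> actions of the history are known to be leaves. The tail is filled with an
    arbitrary leaf, which the precisions at rounds below \<open>n\<close> do not see.\<close>
  define acts where "acts l = (if l < n then fst (h l) else a0)" for l
  have aL: "acts l \<in> L" for l using good a0 by (simp add: acts_def)
  have eq: "psd t h (fst (h t)) = sqrt (pvar (hat acts t) (acts t))" if "t < n" for t
    unfolding psd_def using that by (subst hat_cong[of t "acts_of h" acts]) (auto simp: acts_def)
  have nn: "0 \<le> pvar (hat acts t) (acts t)" for t
    using pvar_pos[of "acts t" "hat acts t"] hat_pos aL[of t] L_sub by force
  let ?x = "\<lambda>t. sqrt (pvar (hat acts t) (acts t))"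
  have "(\<Sum>t<n. 1 * ?x t)\<^sup>2 \<le> (\<Sum>t<n. 1\<^sup>2) * (\<Sum>t<n. (?x t)\<^sup>2)"
    by (rule Cauchy_Schwarz_ineq_sum)
  also have "\<dots> = real n * (\<Sum>t<n. pvar (hat acts t) (acts t))" using nn by simp
  also have "\<dots> \<le> real n * G V r pa s0 s c n"
    using sum_pvar_le_G[OF c0, of n acts] c aL by (intro mult_left_mono) auto
  finally have "(\<Sum>t<n. ?x t) \<le> sqrt (real n * G V r pa s0 s c n)"
    by (intro real_le_rsqrt) simp
  thus ?thesis using eq by simp
qed

lemma bayes_regret_le:
  assumes c0: "c > 0"
    and c: "\<And>acts k i. (\<forall>l. acts l \<in> L) \<Longrightarrow> k < n \<Longrightarrow> i \<in> V \<Longrightarrow> hat acts (Suc k) i \<le> c * hat acts k i"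
    and \<kappa>: "\<kappa> \<ge> 0"
  shows "bayes_regret V r pa mu s0 s n \<le> \<kappa> * sqrt (real n * G V r pa s0 s c n) +
      real n * (sigma_max V r pa s0 * real (card L) * (exp (- \<kappa>\<^sup>2 / 2) / sqrt (2 * pi)))"
    (is "_ \<le> ?A + real n * ?B")
proof -
  interpret prob_space "law n" by (rule prob_law)
  let ?f = "\<lambda>x. \<Sum>t<n. Max (fst x ` L) - fst x (fst (snd x t))"
  define \<Psi>1 where "\<Psi>1 th (h :: nat \<Rightarrow> 'v \<times> real) a = (if a \<in> L then ennreal (Max (th ` L) - th a) else 0)"
    for th :: "'v \<Rightarrow> real" and h a
  define \<Psi>2 where "\<Psi>2 t (th :: 'v \<Rightarrow> real) h a = (if a \<in> L then ennreal (\<kappa> * psd t h a) else 0)"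
    for t th h a
  have comp [measurable]: "(\<lambda>th. th a) \<in> borel_measurable PM" if "a \<in> L" for a
  proof -
    have "a \<in> V" using that L_sub by blast
    thus ?thesis by measurable
  qed
  have [measurable]: "(\<lambda>x. fst x (act (fst x))) \<in> borel_measurable SM"
    by (rule param_measurable[where f = fst]) (simp_all add: SM_eq)
  have m1: "(\<lambda>x. \<Psi>1 (fst x) (snd x) a) \<in> borel_measurable SM" if "a \<in> L" for a
  proof -
    have [measurable]: "(\<lambda>x. fst x a) \<in> borel_measurable SM"
      using comp[OF that] unfolding SM_eq by measurable
    show ?thesis using that unfolding \<Psi>1_def max_eq_act by simp
  qed
  have m2: "(\<lambda>x. \<Psi>2 t (fst x) (snd x) a) \<in> borel_measurable SM" if "a \<in> L" for a t
    using that unfolding \<Psi>2_def SM_eq by simp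
  have z1: "\<Psi>1 th h a = 0" and z2: "\<Psi>2 t th h a = 0" if "a \<notin> L" for t th h a
    using that by (auto simp: \<Psi>1_def \<Psi>2_def)
  have p1: "\<Psi>1 th (h(k := z)) a = \<Psi>1 th h a" for th h k z a by (simp add: \<Psi>1_def)
  have p2: "\<Psi>2 t th (h(k := z)) a = \<Psi>2 t th h a" if "t \<le> k" for t th h k z a
    using psd_past[OF that] by (simp add: \<Psi>2_def)
  have B0: "0 \<le> ?B"
  proof -
    obtain a where "a \<in> L" using leaves_nonempty by blast
    hence "0 \<le> sigma_max V r pa s0" using psd_le[of a 0 "\<lambda>_. undefined"] psd_pos[of a] L_sub
      by (meson less_imp_le order_trans subsetD)
    thus ?thesis by simp
  qed
  have A0: "0 \<le> ?A" using \<kappa> G_nonneg[OF c0] by simp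
  have round: "(\<integral>\<^sup>+x. \<Psi>1 (fst x) (snd x) (fst (snd x t)) \<partial>law n)
      \<le> (\<integral>\<^sup>+x. \<Psi>2 t (fst x) (snd x) (fst (snd x t)) \<partial>law n) + ennreal ?B" if t: "t < n" for t
  proof -
    have "(\<integral>\<^sup>+x. \<Psi>1 (fst x) (snd x) (fst (snd x t)) \<partial>law n)
      = (\<integral>\<^sup>+x. \<integral>\<^sup>+th. \<integral>\<^sup>+Th. \<Psi>1 th (snd x) (act Th) \<partial>post t (snd x) \<partial>post t (snd x) \<partial>law t)"
      by (rule round_expectation(2)[where \<Psi> = \<Psi>1, OF m1 z1 p1 t])
    also have "\<dots> \<le> (\<integral>\<^sup>+x. (\<integral>\<^sup>+Th. \<Psi>2 t (fst x) (snd x) (act Th) \<partial>post t (snd x)) + ennreal ?B \<partial>law t)"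
    proof (rule nn_integral_mono_AE, rule AE_mp[OF AE_actions], intro AE_I2 impI)
      fix x :: "('v \<Rightarrow> real) \<times> (nat \<Rightarrow> 'v \<times> real)"
      assume "\<forall>l<t. fst (snd x l) \<in> L"
      from posterior_regret[of t "snd x" \<kappa>, OF _ \<kappa>] this
      show "(\<integral>\<^sup>+th. \<integral>\<^sup>+Th. \<Psi>1 th (snd x) (act Th) \<partial>post t (snd x) \<partial>post t (snd x))
        \<le> (\<integral>\<^sup>+Th. \<Psi>2 t (fst x) (snd x) (act Th) \<partial>post t (snd x)) + ennreal ?B"
        by (simp add: \<Psi>1_def \<Psi>2_def)
    qed
    also have "\<dots> = (\<integral>\<^sup>+x. \<integral>\<^sup>+Th. \<Psi>2 t (fst x) (snd x) (act Th) \<partial>post t (snd x) \<partial>law t) + ennreal ?B"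
      using round_expectation(3)[where \<Psi> = "\<Psi>2 t", OF m2 z2 p2 t] prob_space.emeasure_space_1[OF prob_law[of t]]
      by (subst nn_integral_add) auto
    \<comment> \<open>\<open>\<Psi>2\<close> ignores the parameters, so the extra posterior integral
      is trivial and the expectation refers again to the action played under \<open>law n\<close>.
      The rounds can then be summed along one realised sequence of actions.\<close>
    also have "(\<integral>\<^sup>+x. \<integral>\<^sup>+Th. \<Psi>2 t (fst x) (snd x) (act Th) \<partial>post t (snd x) \<partial>law t)
      = (\<integral>\<^sup>+x. \<Psi>2 t (fst x) (snd x) (fst (snd x t)) \<partial>law n)"
      using prob_space.emeasure_space_1[OF prob_post]
      by (subst round_expectation(2)[where \<Psi> = "\<Psi>2 t", OF m2 z2 p2 t]) (auto simp: \<Psi>2_def)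
    finally show ?thesis .
  qed
  have "(\<integral>\<^sup>+x. ennreal (?f x) \<partial>law n) \<le> (\<integral>\<^sup>+x. (\<Sum>t<n. \<Psi>1 (fst x) (snd x) (fst (snd x t))) \<partial>law n)"
  proof (rule nn_integral_mono_AE, rule AE_mp[OF AE_actions], intro AE_I2 impI)
    fix x :: "('v \<Rightarrow> real) \<times> (nat \<Rightarrow> 'v \<times> real)"
    assume g: "\<forall>t<n. fst (snd x t) \<in> L"
    have "ennreal (?f x) = (\<Sum>t<n. ennreal (Max (fst x ` L) - fst x (fst (snd x t))))"
      using g by (intro sum_ennreal[symmetric]) simp
    also have "\<dots> = (\<Sum>t<n. \<Psi>1 (fst x) (snd x) (fst (snd x t)))"
      using g by (simp add: \<Psi>1_def)
    finally show "ennreal (?f x) \<le> (\<Sum>t<n. \<Psi>1 (fst x) (snd x) (fst (snd x t)))" by simp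
  qed
  also have "\<dots> = (\<Sum>t<n. \<integral>\<^sup>+x. \<Psi>1 (fst x) (snd x) (fst (snd x t)) \<partial>law n)"
  proof (rule nn_integral_sum)
    fix t assume "t \<in> {..<n}"
    hence "t < n" by simp
    from round_expectation(1)[where \<Psi> = \<Psi>1, OF m1 z1 p1 this]
    show "(\<lambda>x. \<Psi>1 (fst x) (snd x) (fst (snd x t))) \<in> borel_measurable (law n)" by simp
  qed
  also have "\<dots> \<le> (\<Sum>t<n. (\<integral>\<^sup>+x. \<Psi>2 t (fst x) (snd x) (fst (snd x t)) \<partial>law n) + ennreal ?B)"
    by (rule sum_mono) (use round in auto)
  also have "\<dots> = (\<integral>\<^sup>+x. (\<Sum>t<n. \<Psi>2 t (fst x) (snd x) (fst (snd x t))) \<partial>law n) + ennreal (real n * ?B)"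
  proof -
    have "(\<Sum>t<n. \<integral>\<^sup>+x. \<Psi>2 t (fst x) (snd x) (fst (snd x t)) \<partial>law n)
      = (\<integral>\<^sup>+x. (\<Sum>t<n. \<Psi>2 t (fst x) (snd x) (fst (snd x t))) \<partial>law n)"
    proof (rule nn_integral_sum[symmetric])
      fix t assume "t \<in> {..<n}"
      hence "t < n" by simp
      from round_expectation(1)[where \<Psi> = "\<Psi>2 t", OF m2 z2 p2 this]
      show "(\<lambda>x. \<Psi>2 t (fst x) (snd x) (fst (snd x t))) \<in> borel_measurable (law n)" by simp
    qed
    moreover have "(\<Sum>t<n. ennreal ?B) = ennreal (real n * ?B)"
      using B0 by (simp only: sum_constant card_lessThan ennreal_of_nat_eq_real_of_nat ennreal_mult'' mult.commute)
    ultimately show ?thesis by (simp only: sum.distrib)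
  qed
  also have "\<dots> \<le> (\<integral>\<^sup>+x. ennreal ?A \<partial>law n) + ennreal (real n * ?B)"
  proof (intro add_right_mono, rule nn_integral_mono_AE, rule AE_mp[OF AE_actions], intro AE_I2 impI)
    fix x :: "('v \<Rightarrow> real) \<times> (nat \<Rightarrow> 'v \<times> real)"
    assume g: "\<forall>t<n. fst (snd x t) \<in> L"
    have "(\<Sum>t<n. \<Psi>2 t (fst x) (snd x) (fst (snd x t))) = (\<Sum>t<n. ennreal (\<kappa> * psd t (snd x) (fst (snd x t))))"
      using g by (simp add: \<Psi>2_def)
    also have "\<dots> = ennreal (\<Sum>t<n. \<kappa> * psd t (snd x) (fst (snd x t)))"
    proof (rule sum_ennreal)
      fix t assume "t \<in> {..<n}"
      hence "fst (snd x t) \<in> V" using g L_sub by blast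
      thus "0 \<le> \<kappa> * psd t (snd x) (fst (snd x t))" using \<kappa> psd_pos[of "fst (snd x t)"] by (simp add: less_imp_le)
    qed
    also have "\<dots> = ennreal (\<kappa> * (\<Sum>t<n. psd t (snd x) (fst (snd x t))))" by (simp add: sum_distrib_left)
    also have "\<dots> \<le> ennreal ?A"
      using \<kappa> g by (intro ennreal_leI mult_left_mono sum_psd_le[OF c0 c]) auto
    finally show "(\<Sum>t<n. \<Psi>2 t (fst x) (snd x) (fst (snd x t))) \<le> ennreal ?A" .
  qed
  also have "\<dots> = ennreal (?A + real n * ?B)"
  proof -
    have "0 \<le> real n * ?B" by (rule mult_nonneg_nonneg[OF of_nat_0_le_iff B0])
    moreover have "(\<integral>\<^sup>+x. ennreal ?A \<partial>law n) = ennreal ?A"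
      using emeasure_space_1 by (simp del: space_law)
    ultimately show ?thesis using A0 by (simp only: ennreal_plus)
  qed
  finally have nn: "(\<integral>\<^sup>+x. ennreal (?f x) \<partial>law n) \<le> ennreal (?A + real n * ?B)" .
  have R0: "0 \<le> ?A + real n * ?B"
    by (intro add_nonneg_nonneg A0 mult_nonneg_nonneg of_nat_0_le_iff B0)
  have "(\<integral>x. ?f x \<partial>law n) \<le> ?A + real n * ?B"
  \<comment> \<open>The nonnegative integral controls the positive part of the regret, which
    suffices from above. Without integrability the Bochner integral is 0, and the bound is
    nonnegative.\<close>
  proof (cases "integrable (law n) ?f")
    case True
    have "(\<integral>x. ?f x \<partial>law n) \<le> enn2real (\<integral>\<^sup>+x. ennreal (?f x) \<partial>law n)"
      using real_lebesgue_integral_def[OF True] by simp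
    also have "\<dots> \<le> ?A + real n * ?B" by (rule enn2real_leI[OF R0 nn])
    finally show ?thesis .
  next
    case False
    thus ?thesis using R0 by (simp add: not_integrable_integral_eq)
  qed
  thus ?thesis unfolding bayes_regret_def .
qed

end

theorem theorem1:
  fixes V :: "'v set" and r :: 'v and pa :: "'v \<Rightarrow> 'v"
    and mu s c \<delta> :: real and s0 :: "'v \<Rightarrow> real" and n :: nat
  assumes tree: "is_tree V r pa"
    and s_pos: "s > 0"
    and s0_pos: "\<forall>i\<in>V. s0 i > 0"
    and c_pos: "c > 0"
    and hc: "\<forall>acts :: nat \<Rightarrow> 'v. (\<forall>l. acts l \<in> leaves V r pa) \<longrightarrow>
               (\<forall>k<n. \<forall>i\<in>V. c * hat_prec V r pa s0 s acts k i \<ge> hat_prec V r pa s0 s acts (Suc k) i)"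
    and \<delta>: "0 < \<delta>" "\<delta> \<le> 1"
  shows "bayes_regret V r pa mu s0 s n
           \<le> sqrt (2 * real n * G V r pa s0 s c n * ln (1 / \<delta>))
             + sqrt (2 / pi) * sigma_max V r pa s0 * real (card (leaves V r pa)) * real n * \<delta>"
proof -
  interpret gauss_tree V r pa mu s s0
    using tree s_pos s0_pos by unfold_locales auto
  \<comment> \<open>Chosen so that the exponential factor in the Gaussian excess equals
    \<open>\<delta>\<close>.\<close>
  define \<kappa> where "\<kappa> = sqrt (2 * ln (1 / \<delta>))"
  have ln0: "0 \<le> ln (1 / \<delta>)" using \<delta> by simp
  have \<kappa>: "0 \<le> \<kappa>" "\<kappa>\<^sup>2 = 2 * ln (1 / \<delta>)" using ln0 by (auto simp: \<kappa>_def)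
  have e: "exp (- \<kappa>\<^sup>2 / 2) = \<delta>" using \<delta> by (simp add: \<kappa>(2) ln_div)
  have "\<kappa> * sqrt (real n * G V r pa s0 s c n) = sqrt (2 * real n * G V r pa s0 s c n * ln (1 / \<delta>))"
    by (simp add: \<kappa>_def real_sqrt_mult[symmetric] mult_ac)
  moreover have "real n * (sigma_max V r pa s0 * real (card (leaves V r pa)) * (\<delta> / sqrt (2 * pi)))
     \<le> sqrt (2 / pi) * sigma_max V r pa s0 * real (card (leaves V r pa)) * real n * \<delta>"
  proof -
    obtain a where a: "a \<in> leaves V r pa" using leaves_nonempty by blast
    have "0 < psd 0 (\<lambda>_. undefined) a" using a L_sub by (intro psd_pos) auto
    hence sm: "0 \<le> sigma_max V r pa s0" using psd_le[OF a, of 0 "\<lambda>_. undefined"] by linarith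
    \<comment> \<open>The right side is twice the left: the one-sided excess costs half of the
      stated constant.\<close>
    have "1 / sqrt (2 * pi) \<le> sqrt (2 / pi)"
      by (simp add: real_sqrt_divide real_sqrt_mult field_simps)
    hence "(sigma_max V r pa s0 * real (card (leaves V r pa)) * real n * \<delta>) * (1 / sqrt (2 * pi))
      \<le> (sigma_max V r pa s0 * real (card (leaves V r pa)) * real n * \<delta>) * sqrt (2 / pi)"
      using sm \<delta> by (intro mult_left_mono) auto
    thus ?thesis by (simp add: mult_ac)
  qed
  moreover
  have hc': "hat_prec V r pa s0 s acts (Suc k) i \<le> c * hat_prec V r pa s0 s acts k i"
    if "\<forall>l. acts l \<in> leaves V r pa" "k < n" "i \<in> V" for acts k i
    using hc that by blast
  have "bayes_regret V r pa mu s0 s n \<le> \<kappa> * sqrt (real n * G V r pa s0 s c n) +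
      real n * (sigma_max V r pa s0 * real (card (leaves V r pa)) * (exp (- \<kappa>\<^sup>2 / 2) / sqrt (2 * pi)))"
    by (rule bayes_regret_le[OF c_pos hc' \<kappa>(1)])
  ultimately show ?thesis unfolding e by linarith
qed

end
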